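(* The structure $\mathbf{S}^{\mathrm{Pure}}_\approx$ is bi-interpretable with the structure $\tilde{\mathbb{H}}^{\mathrm{Pure}}$, and $\mathbf{S}^{\mathrm{Pure}}_\approx(\mathrm{CM})$ is bi-interpretable with $\tilde{\mathbb{H}}^{\mathrm{Pure}}(\mathrm{CM})$. (That is: every automorphism of $\mathbf{S}^{\mathrm{Pure}}$ induces an automorphism of $\tilde{\mathbb{H}}^{\mathrm{Pure}}$ and every automorphism of $\tilde{\mathbb{H}}^{\mathrm{Pure}}$ lifts to an automorphism of $\mathbf{S}^{\mathrm{Pure}}$; and likewise for the substructures on CM-points.)
   Context: $\mathbb{H}$ is the upper half-plane, $\mathbb{H}^{\pm}=\mathbb{C}\setminus\mathbb{R}$, $\mathbb{A}_f$ the finite adeles of $\mathbb{Q}$, $\mathbb{Q}_+$ the positive rationals, $\mathbf d_\lambda=\mathrm{diag}(\lambda,1)$, $\Delta=\{\mathbf d_\lambda:\lambda\in\hat{\mathbb{Z}}^\times\}$, $\Delta(\mathbb{Q}_+)=\{\mathbf d_q:q\in\mathbb{Q}_+\}$, $\tilde\Gamma(N)=\{g\in\mathrm{SL}_2(\hat{\mathbb{Z}}):g\equiv1\bmod N\}$. $\mathrm{S}=\mathrm{GL}_2(\mathbb{Q})\backslash(\mathbb{H}^{\pm}\times\mathrm{GL}_2(\mathbb{A}_f))$ with $q\cdot(\tau,a)=(q\tau,qa)$; classes $[\tau,a]$; $g*[\tau,a]=[\tau,ag^{-1}]$. Components $\mathrm{S}^\mu=\{[\tau,a]:\tau\in\mathbb{H},\det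 a\in\mathbb{Q}_+\mu\}$, $\mu\in\hat{\mathbb{Z}}^\times$; $E$ is the relation of lying in the same component. $\mathbf{S}^{\mathrm{Pure}}$ is the set $\mathrm{S}$ with the operations $s\mapsto g*s$ ($g\in\mathrm{GL}_2(\mathbb{A}_f)$), the relation $E$, and the quotients $\mathrm{S}/K(N)$, $K(N)=\{g\in\mathrm{GL}_2(\hat{\mathbb{Z}}):g\equiv1\bmod N\}$, with all induced maps and relations; its automorphisms are the bijections of $\mathrm{S}$ commuting with all $g*$ and preserving $E$. CM-points of $\mathrm{S}$ are the $[\tau,a]$ with $\tau$ imaginary quadratic; $\mathbf{S}^{\mathrm{Pure}}(\mathrm{CM})$ is the substructure on them. $\mathrm{S}_\approx=\mathrm{S}/\Delta$ (identified with $\tilde{\mathbb{H}}=\varprojlim_N\Gamma(N)\backslash\mathbb{H}$); the class of $[\tau,a]$ is $[\tau,a]_\approx=[\tau,a\Delta]$, and each class has a canonical representative $[\tau,a]$ with $\tau\in\mathbb{H}$, $\det a\in\mathbb{Q}_+$. $\mathbf{S}^{\mathrm{Pure}}_\approx$ is the structure on $\mathrm{S}_\approx$ induced from $\mathbf{S}^{\mathrm{Pure}}$, i.e. the one for which the quotient map induces an epimorphism $\mathrm{Aut}\,\mathbf{S}^{\mathrm{Pure}}\twoheadrightarrow\mathrm{Aut}\,\mathbf{S}^{\mathrm{Pure}}_\approx$; $\mathbf{S}^{\mathrm{Pure}}_\approx(\mathrm{CM})$ is its substructure on the images of CM-points. For $\tau$ imaginary quadratic, $G_\tau=\{q\in\mathrm{GL}_2(\mathbb{Q}):q\tau=\tau\}$,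 $N_\tau=\{w\in\mathrm{GL}_2(\mathbb{A}_f):wG_\tau w^{-1}=G_\tau\}$. For imaginary quadratic $\tau_1,\tau_2$, the relation $R_{\tau_1,\tau_2}(s_1,s_2,t_1,t_2)$ on $\mathrm{S}_\approx$ holds iff $s_i=[\tau_i,a_i]_\approx$, $t_i=[\tau_i,b_i]_\approx$ ($i=1,2$) in canonical representation ($\det a_i,\det b_i\in\mathbb{Q}_+$) and there are $r_i\in N_{\tau_i}$ with $\det r_1=\det r_2\in\hat{\mathbb{Z}}^\times$ and $b_i=r_i\,a_i\,\mathbf d_{\det r_i}^{-1}$ for $i=1,2$. $R$ is the disjunction of the $R_{\sqrt{-m_1},\sqrt{-m_2}}$ over square-free positive integers $m_1,m_2$. $\tilde{\mathbb{H}}^{\mathrm{Pure}}$ is the two-sorted structure with sorts $\mathrm{S}_\approx$ (also called $\tilde{\mathbb{H}}$) and $\tilde{\mathrm{G}}$, where: $\tilde{\mathrm{G}}$ is a group isomorphic to $\Delta(\mathbb{Q}_+)\cdot\mathrm{SL}_2(\mathbb{A}_f)\subset\mathrm{GL}_2(\mathbb{A}_f)$, acting on $\mathrm{S}_\approx$ by the action induced from $\mathbf{S}^{\mathrm{Pure}}$, i.e. $g*[\tau,a\Delta]=[\tau,ag^{-1}\Delta]$ for $\det a\in\mathbb{Q}_+$; for each $g\in\tilde{\mathrm{G}}$ the set $g^\Delta=\{\mathbf d_\mu^{-1}g\,\mathbf d_\mu:\mu\in\hat{\mathbb{Z}}^\times\}$ is definable (invariant under automorphisms); the subgroups $\tilde\Gamma(N)\subset\tilde{\mathrm{G}}$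 are definable; for any special (CM) $s_1,s_2\in\mathrm{S}_\approx$ the set $\{(t_1,t_2)\in\mathrm{S}_\approx^2:R(s_1,s_2,t_1,t_2)\}$ is definable. $\tilde{\mathbb{H}}^{\mathrm{Pure}}(\mathrm{CM})$ is the substructure with $\mathrm{S}_\approx$ replaced by its set of CM-points. *)

theory Defs
  imports
    "HOL-Analysis.Analysis"
    "HOL-Algebra.Bij"
    "HOL-Computational_Algebra.Squarefree"
begin

section \<open>The profinite integers and the finite adeles of the rationals\<close>

text \<open>
  The profinite integers are the inverse limit of the rings \<open>\<int>/N\<int>\<close> over \<open>N \<ge> 1\<close>. The component at \<open>N\<close> is the
  representative in \<open>{0..<N}\<close>; the index \<open>0\<close> carries no information.
\<close>

definition compatible :: "(nat \<Rightarrow> int) \<Rightarrow> bool" where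
  "compatible x \<longleftrightarrow> x 0 = 0 \<and> (\<forall>N>0. \<forall>M. M dvd N \<longrightarrow> x M = x N mod int M)"

typedef zhat = "{x. compatible x}"
  by (rule exI[of _ "\<lambda>_. 0"]) (simp add: compatible_def)

setup_lifting type_definition_zhat

definition residue_family :: "(nat \<Rightarrow> int) \<Rightarrow> nat \<Rightarrow> int" where
  "residue_family f N = (if N = 0 then 0 else f N mod int N)"

lemma compatible_residue_family:
  assumes "\<And>M N. 0 < N \<Longrightarrow> M dvd N \<Longrightarrow> f M mod int M = f N mod int M"
  shows "compatible (residue_family f)"
  unfolding compatible_def
proof (intro conjI allI impI)
  show "residue_family f 0 = 0" by (simp add: residue_family_def)
  fix N M :: nat assume N: "0 < N" and M: "M dvd N"
  then have "0 < M" by (meson dvd_pos_nat)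
  then show "residue_family f M = residue_family f N mod int M"
    using assms[OF N M] N M by (simp add: residue_family_def mod_mod_cancel)
qed

lemma compatible_0: "compatible x \<Longrightarrow> x 0 = 0"
  unfolding compatible_def by blast

lemma compatible_dvd: "compatible x \<Longrightarrow> 0 < N \<Longrightarrow> M dvd N \<Longrightarrow> x M = x N mod int M"
  unfolding compatible_def by blast

lemma compatible_mod: "compatible x \<Longrightarrow> 0 < N \<Longrightarrow> M dvd N \<Longrightarrow> x M mod int M = x N mod int M"
  using compatible_dvd[of x N M] by simp

instantiation zhat :: comm_ring_1
begin

lift_definition zero_zhat :: zhat is "\<lambda>_. 0" by (simp add: compatible_def)

lift_definition one_zhat :: zhat is "residue_family (\<lambda>_. 1)"
  by (rule compatible_residue_family) simp

lift_definition plus_zhat :: "zhat \<Rightarrow> zhat \<Rightarrow> zhat" is "\<lambda>x y. residue_family (\<lambda>N. x N + y N)"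
  by (rule compatible_residue_family, rule mod_add_cong) (rule compatible_mod; assumption)+

lift_definition uminus_zhat :: "zhat \<Rightarrow> zhat" is "\<lambda>x. residue_family (\<lambda>N. - x N)"
  by (rule compatible_residue_family, rule mod_minus_cong) (rule compatible_mod; assumption)

lift_definition minus_zhat :: "zhat \<Rightarrow> zhat \<Rightarrow> zhat" is "\<lambda>x y. residue_family (\<lambda>N. x N - y N)"
  by (rule compatible_residue_family, rule mod_diff_cong) (rule compatible_mod; assumption)+

lift_definition times_zhat :: "zhat \<Rightarrow> zhat \<Rightarrow> zhat" is "\<lambda>x y. residue_family (\<lambda>N. x N * y N)"
  by (rule compatible_residue_family, rule mod_mult_cong) (rule compatible_mod; assumption)+

instance
proof
  have compat: "compatible (Rep_zhat x)" for x
    using Rep_zhat[of x] by simp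
  have norm: "Rep_zhat x N mod int N = Rep_zhat x N" if "0 < N" for x N
    using compatible_dvd[OF compat that dvd_refl] by simp
  have eqI: "x = y" if "\<And>N. 0 < N \<Longrightarrow> Rep_zhat x N = Rep_zhat y N" for x y
  proof (rule Rep_zhat_inject[THEN iffD1], rule ext)
    fix N show "Rep_zhat x N = Rep_zhat y N"
      using that[of N] compatible_0[OF compat[of x]] compatible_0[OF compat[of y]]
      by (cases "N = 0") simp_all
  qed
  note reps = zero_zhat.rep_eq one_zhat.rep_eq plus_zhat.rep_eq uminus_zhat.rep_eq
    minus_zhat.rep_eq times_zhat.rep_eq residue_family_def
  fix a b c :: zhat
  show "a * b * c = a * (b * c)"
    by (rule eqI) (simp add: reps mod_simps mult.assoc)
  show "a * b = b * a"
    by (rule eqI) (simp add: reps mult.commute)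
  show "1 * a = a"
    by (rule eqI) (simp add: reps mod_simps norm)
  show "a + b + c = a + (b + c)"
    by (rule eqI) (simp add: reps mod_simps add.assoc)
  show "a + b = b + a"
    by (rule eqI) (simp add: reps add.commute)
  show "0 + a = a"
    by (rule eqI) (simp add: reps norm)
  show "- a + a = 0"
    by (rule eqI) (simp add: reps mod_simps)
  show "a - b = a + - b"
    by (rule eqI) (simp add: reps mod_simps)
  show "(a + b) * c = a * c + b * c"
    by (rule eqI) (simp add: reps mod_simps distrib_right)
  have "Rep_zhat 0 2 \<noteq> Rep_zhat 1 2"
    by (simp add: reps)
  then show "(0::zhat) \<noteq> 1" by metis
qed

end

lemma Rep_zhat_of_nat: "Rep_zhat (of_nat n) = residue_family (\<lambda>_. int n)"
proof (induction n)
  case 0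
  show ?case by (simp add: zero_zhat.rep_eq residue_family_def fun_eq_iff)
next
  case (Suc n)
  then show ?case
    by (simp add: plus_zhat.rep_eq one_zhat.rep_eq residue_family_def fun_eq_iff mod_simps)
qed

lemma zhat_torsion_free:
  assumes "of_nat n * x = (0 :: zhat)" "0 < n"
  shows "x = 0"
proof -
  have compat: "compatible (Rep_zhat x)"
    using Rep_zhat[of x] by simp
  have "Rep_zhat x N = 0" for N
  proof (cases "N = 0")
    case True
    then show ?thesis using compatible_0[OF compat] by simp
  next
    case False
    have "Rep_zhat (of_nat n * x) (n * N) = 0"
      by (simp add: assms(1) zero_zhat.rep_eq)
    then have "(int n * Rep_zhat x (n * N)) mod int (n * N) = 0"
      using False assms(2)
      by (simp add: times_zhat.rep_eq Rep_zhat_of_nat residue_family_def mod_mult_left_eq)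
    then have "int n * (Rep_zhat x (n * N) mod int N) = 0"
      by (metis mult_mod_right of_nat_mult)
    then have "Rep_zhat x (n * N) mod int N = 0"
      using assms(2) by simp
    moreover have "Rep_zhat x N = Rep_zhat x (n * N) mod int N"
      using compatible_dvd[OF compat, of "n * N" N] False assms(2) by simp
    ultimately show ?thesis by simp
  qed
  then show ?thesis
    by (simp add: Rep_zhat_inject[symmetric] zero_zhat.rep_eq fun_eq_iff)
qed

lemma zhat_cancel:
  assumes "of_nat n * x = of_nat n * (y :: zhat)" "0 < n"
  shows "x = y"
  using zhat_torsion_free[of n "x - y"] assms by (simp add: right_diff_distrib)

lifting_forget zhat.lifting

text \<open>
  The ring of finite adeles is the tensor product of the profinite integers with the rationals, that
  is, the localisation of the profinite integers at the positive integers: the pair \<open>(x, m)\<close> stands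
  for \<open>x / m\<close>. No extra factor is needed in the equality of fractions since the profinite integers
  are torsion-free.
\<close>

definition adele_rel :: "zhat \<times> nat \<Rightarrow> zhat \<times> nat \<Rightarrow> bool" where
  "adele_rel p q \<longleftrightarrow> 0 < snd p \<and> 0 < snd q \<and> fst p * of_nat (snd q) = fst q * of_nat (snd p)"

lemma part_equivp_adele_rel: "part_equivp adele_rel"
proof (rule part_equivpI)
  show "\<exists>p. adele_rel p p"
    by (rule exI[of _ "(0, 1)"]) (simp add: adele_rel_def)
  show "symp adele_rel"
    by (auto simp: symp_def adele_rel_def)
  show "transp adele_rel"
  proof (rule transpI, unfold split_paired_all)
    fix x y z :: zhat and l m n :: nat
    assume 1: "adele_rel (x, l) (y, m)" and 2: "adele_rel (y, m) (z, n)"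
    have xy: "x * of_nat m = y * of_nat l" and yz: "y * of_nat n = z * of_nat m"
      using 1 2 by (auto simp: adele_rel_def)
    have "of_nat m * (x * of_nat n) = of_nat n * (x * of_nat m)" by (simp only: ac_simps)
    also have "\<dots> = of_nat l * (y * of_nat n)" unfolding xy by (simp only: ac_simps)
    also have "\<dots> = of_nat m * (z * of_nat l)" unfolding yz by (simp only: ac_simps)
    finally have "of_nat m * (x * of_nat n) = of_nat m * (z * of_nat l)" .
    moreover have "0 < m" using 1 by (simp add: adele_rel_def)
    ultimately have "x * of_nat n = z * of_nat l" by (rule zhat_cancel)
    then show "adele_rel (x, l) (z, n)"
      using 1 2 by (simp only: adele_rel_def fst_conv snd_conv)
  qed
qed

quotient_type adele = "zhat \<times> nat" / partial: adele_rel
  by (rule part_equivp_adele_rel)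

lift_definition adele_frac :: "zhat \<Rightarrow> nat \<Rightarrow> adele" is "\<lambda>x m. if m = 0 then (0, 1) else (x, m)"
  by (simp add: adele_rel_def)

lemma adele_cases [cases type: adele]:
  obtains (adele_frac) x m where "a = adele_frac x m" "0 < m"
  by transfer (auto simp: adele_rel_def)

lemma adele_frac_eq_iff:
  "0 < m \<Longrightarrow> 0 < n \<Longrightarrow> adele_frac x m = adele_frac y n \<longleftrightarrow> x * of_nat n = y * of_nat m"
  by transfer (simp add: adele_rel_def)

instantiation adele :: comm_ring_1
begin

lift_definition zero_adele :: adele is "(0, 1)" by (simp add: adele_rel_def)

lift_definition one_adele :: adele is "(1, 1)" by (simp add: adele_rel_def)

lift_definition plus_adele :: "adele \<Rightarrow> adele \<Rightarrow> adele"
  is "\<lambda>p q. (fst p * of_nat (snd q) + fst q * of_nat (snd p), snd p * snd q)"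
proof -
  fix p p' q q' :: "zhat \<times> nat"
  assume 1: "adele_rel p p'" and 2: "adele_rel q q'"
  obtain x l x' l' y m y' m' where eqs: "p = (x, l)" "p' = (x', l')" "q = (y, m)" "q' = (y', m')"
    by (metis surj_pair)
  have x: "x * of_nat l' = x' * of_nat l" and y: "y * of_nat m' = y' * of_nat m"
    using 1 2 by (auto simp: adele_rel_def eqs)
  have "(x * of_nat m + y * of_nat l) * (of_nat l' * of_nat m')
      = (x * of_nat l') * (of_nat m * of_nat m') + (y * of_nat m') * (of_nat l * of_nat l')"
    by (simp add: algebra_simps)
  also have "\<dots> = (x' * of_nat m' + y' * of_nat l') * (of_nat l * of_nat m)"
    unfolding x y by (simp add: algebra_simps)
  finally show "adele_rel (fst p * of_nat (snd q) + fst q * of_nat (snd p), snd p * snd q)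
      (fst p' * of_nat (snd q') + fst q' * of_nat (snd p'), snd p' * snd q')"
    using 1 2 by (simp add: adele_rel_def eqs)
qed

lift_definition uminus_adele :: "adele \<Rightarrow> adele" is "\<lambda>p. (- fst p, snd p)"
  by (simp add: adele_rel_def)

definition minus_adele :: "adele \<Rightarrow> adele \<Rightarrow> adele" where
  "minus_adele a b = a + - b"

lift_definition times_adele :: "adele \<Rightarrow> adele \<Rightarrow> adele"
  is "\<lambda>p q. (fst p * fst q, snd p * snd q)"
proof -
  fix p p' q q' :: "zhat \<times> nat"
  assume 1: "adele_rel p p'" and 2: "adele_rel q q'"
  obtain x l x' l' y m y' m' where eqs: "p = (x, l)" "p' = (x', l')" "q = (y, m)" "q' = (y', m')"
    by (metis surj_pair)
  have x: "x * of_nat l' = x' * of_nat l" and y: "y * of_nat m' = y' * of_nat m"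
    using 1 2 by (auto simp: adele_rel_def eqs)
  have "(x * y) * (of_nat l' * of_nat m') = (x * of_nat l') * (y * of_nat m')"
    by (simp add: ac_simps)
  also have "\<dots> = (x' * y') * (of_nat l * of_nat m)"
    unfolding x y by (simp add: ac_simps)
  finally show "adele_rel (fst p * fst q, snd p * snd q) (fst p' * fst q', snd p' * snd q')"
    using 1 2 by (simp add: adele_rel_def eqs)
qed

lemma add_adele_frac:
  "0 < m \<Longrightarrow> 0 < n \<Longrightarrow>
    adele_frac x m + adele_frac y n = adele_frac (x * of_nat n + y * of_nat m) (m * n)"
  by transfer (simp add: adele_rel_def)

lemma uminus_adele_frac: "0 < m \<Longrightarrow> - adele_frac x m = adele_frac (- x) m"
  by transfer (simp add: adele_rel_def)

lemma mult_adele_frac: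
  "0 < m \<Longrightarrow> 0 < n \<Longrightarrow> adele_frac x m * adele_frac y n = adele_frac (x * y) (m * n)"
  by transfer (simp add: adele_rel_def)

lemma zero_adele_frac: "0 = adele_frac 0 1"
  by transfer (simp add: adele_rel_def)

lemma one_adele_frac: "1 = adele_frac 1 1"
  by transfer (simp add: adele_rel_def)

instance
proof
  fix a b c :: adele
  note defs = add_adele_frac uminus_adele_frac mult_adele_frac zero_adele_frac one_adele_frac
    adele_frac_eq_iff algebra_simps
  show "a * b * c = a * (b * c)" by (cases a; cases b; cases c) (simp add: defs)
  show "a * b = b * a" by (cases a; cases b) (simp add: defs)
  show "1 * a = a" by (cases a) (simp add: defs)
  show "a + b + c = a + (b + c)" by (cases a; cases b; cases c) (simp add: defs)
  show "a + b = b + a" by (cases a; cases b) (simp add: defs)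
  show "0 + a = a" by (cases a) (simp add: defs)
  show "- a + a = 0" by (cases a) (simp add: defs)
  show "a - b = a + - b" by (rule minus_adele_def)
  show "(a + b) * c = a * c + b * c" by (cases a; cases b; cases c) (simp add: defs)
  show "(0::adele) \<noteq> 1" by (simp add: defs)
qed

end

lifting_forget adele.lifting

definition adele_of_rat :: "rat \<Rightarrow> adele" where
  "adele_of_rat q = (case quotient_of q of (a, b) \<Rightarrow> adele_frac (of_int a) (nat b))"

definition Zhat :: "adele set" where
  "Zhat = range (\<lambda>x. adele_frac x 1)"

definition Zhat_units :: "adele set" where
  "Zhat_units = {u \<in> Zhat. \<exists>v\<in>Zhat. u * v = 1}"

definition Q_pos :: "adele set" where
  "Q_pos = adele_of_rat ` {q. 0 < q}"

lemma adele_of_rat_Fract: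
  assumes "0 < b"
  shows "adele_of_rat (Fract a b) = adele_frac (of_int a) (nat b)"
proof -
  obtain c d where q: "quotient_of (Fract a b) = (c, d)" by fastforce
  then have d: "0 < d" using quotient_of_denom_pos by blast
  have "Fract a b = Fract c d" using quotient_of_div[OF q] by (simp add: Fract_of_int_quotient)
  then have "a * d = c * b" using assms d by (simp add: eq_rat)
  then have "(of_int c :: zhat) * of_int b = of_int a * of_int d"
    by (metis of_int_mult)
  then have "(of_int c :: zhat) * of_nat (nat b) = of_int a * of_nat (nat d)"
    using assms d by simp
  then show ?thesis
    using assms d by (simp add: adele_of_rat_def q adele_frac_eq_iff)
qed

lemma adele_of_rat_0 [simp]: "adele_of_rat 0 = 0"
  using adele_of_rat_Fract[of 1 0] by (simp add: Zero_rat_def[symmetric] zero_adele_frac)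

lemma adele_of_rat_1 [simp]: "adele_of_rat 1 = 1"
  using adele_of_rat_Fract[of 1 1] by (simp add: One_rat_def[symmetric] one_adele_frac)

lemma adele_of_rat_add: "adele_of_rat (p + q) = adele_of_rat p + adele_of_rat q"
proof (cases p; cases q)
  fix a b c d assume "p = Fract a b" "0 < b" "q = Fract c d" "0 < d"
  then show ?thesis
    by (simp add: adele_of_rat_Fract add_adele_frac nat_mult_distrib)
qed

lemma adele_of_rat_mult: "adele_of_rat (p * q) = adele_of_rat p * adele_of_rat q"
proof (cases p; cases q)
  fix a b c d assume "p = Fract a b" "0 < b" "q = Fract c d" "0 < d"
  then show ?thesis
    by (simp add: adele_of_rat_Fract mult_adele_frac nat_mult_distrib)
qed



section \<open>Two by two matrices\<close>

text \<open>
  The group of invertible \<open>2 \<times> 2\<close> matrices over a ring \<open>R\<close> is represented by the elements of \<open>R^2^2\<close>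
  satisfying the predicate \<open>invertible\<close>.
\<close>

definition adele_matrix :: "rat^2^2 \<Rightarrow> adele^2^2" where
  "adele_matrix = map_matrix adele_of_rat"

definition diag_matrix :: "'a::zero_neq_one \<Rightarrow> 'a^2^2" where
  "diag_matrix u = vector [vector [u, 0], vector [0, 1]]"

definition moebius_act :: "rat^2^2 \<Rightarrow> complex \<Rightarrow> complex" where
  "moebius_act q \<tau> = (of_rat (q $ 1 $ 1) * \<tau> + of_rat (q $ 1 $ 2)) / (of_rat (q $ 2 $ 1) * \<tau> + of_rat (q $ 2 $ 2))"

lemma matrix_inv_both:
  fixes a :: "'a::semiring_1^'n^'n"
  assumes "invertible a"
  shows "a ** matrix_inv a = mat 1" "matrix_inv a ** a = mat 1"
  using someI_ex[OF assms[unfolded invertible_def]] by (auto simp: matrix_inv_def)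

lemma matrix_inv_unique_ring:
  fixes a b :: "'a::semiring_1^'n^'n"
  assumes "a ** b = mat 1" "b ** a = mat 1"
  shows "matrix_inv a = b"
proof -
  have "invertible a" using assms by (auto simp: invertible_def)
  then have "matrix_inv a = matrix_inv a ** (a ** b)" by (simp add: assms)
  also have "\<dots> = b"
    using \<open>invertible a\<close> by (simp add: matrix_mul_assoc matrix_inv_both)
  finally show ?thesis .
qed

lemma invertible_matrix_inv:
  fixes a :: "'a::semiring_1^'n^'n"
  shows "invertible a \<Longrightarrow> invertible (matrix_inv a)"
  unfolding invertible_def[of "matrix_inv a"] using matrix_inv_both by blast

lemma matrix_inv_mult:
  fixes a b :: "'a::semiring_1^'n^'n"
  assumes "invertible a" "invertible b"
  shows "matrix_inv (a ** b) = matrix_inv b ** matrix_inv a"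
proof (rule matrix_inv_unique_ring)
  have "a ** b ** (matrix_inv b ** matrix_inv a) = a ** (b ** matrix_inv b) ** matrix_inv a"
    by (simp only: matrix_mul_assoc)
  then show "a ** b ** (matrix_inv b ** matrix_inv a) = mat 1"
    using assms by (simp add: matrix_inv_both)
  have "matrix_inv b ** matrix_inv a ** (a ** b) = matrix_inv b ** (matrix_inv a ** a) ** b"
    by (simp only: matrix_mul_assoc)
  then show "matrix_inv b ** matrix_inv a ** (a ** b) = mat 1"
    using assms by (simp add: matrix_inv_both)
qed

lemma matrix_eq_2: "(a :: 'a^2^2) = b \<longleftrightarrow> a$1$1 = b$1$1 \<and> a$1$2 = b$1$2 \<and> a$2$1 = b$2$1 \<and> a$2$2 = b$2$2"
  by (auto simp: vec_eq_iff forall_2)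

lemma matrix_mult_2:
  fixes a b :: "'a::semiring_1^2^2"
  shows "(a ** b) $ i $ j = a$i$1 * b$1$j + a$i$2 * b$2$j"
  by (simp add: matrix_matrix_mult_def sum_2)

lemma mat_1_2 [simp]:
  "(mat 1 :: 'a::semiring_1^2^2) $ 1 $ 1 = 1" "(mat 1 :: 'a::semiring_1^2^2) $ 1 $ 2 = 0"
  "(mat 1 :: 'a::semiring_1^2^2) $ 2 $ 1 = 0" "(mat 1 :: 'a::semiring_1^2^2) $ 2 $ 2 = 1"
  by (simp_all add: mat_def)

lemma adele_matrix_mult: "adele_matrix (p ** q) = adele_matrix p ** adele_matrix q"
  by (simp add: adele_matrix_def matrix_eq_2 matrix_mult_2 adele_of_rat_add adele_of_rat_mult)

lemma adele_matrix_1 [simp]: "adele_matrix (mat 1) = mat 1"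
  by (simp add: adele_matrix_def matrix_eq_2)

lemma invertible_adele_matrix: "invertible q \<Longrightarrow> invertible (adele_matrix q)"
  unfolding invertible_def by (metis adele_matrix_mult adele_matrix_1)

lemma diag_matrix_mult: "diag_matrix (u * v) = diag_matrix u ** diag_matrix (v :: 'a::comm_ring_1)"
  by (simp add: diag_matrix_def matrix_eq_2 matrix_mult_2)

lemma diag_matrix_1 [simp]: "diag_matrix 1 = (mat 1 :: 'a::comm_ring_1^2^2)"
  by (simp add: diag_matrix_def matrix_eq_2)

lemma complex_of_rat: "of_rat r = complex_of_real (of_rat r)"
  by (cases r) (simp add: of_rat_rat)

lemma moebius_denominator:
  fixes q :: "rat^2^2"
  assumes "invertible q" "Im \<tau> \<noteq> 0"
  shows "of_rat (q $ 2 $ 1) * \<tau> + of_rat (q $ 2 $ 2) \<noteq> 0"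
proof
  assume 0: "of_rat (q $ 2 $ 1) * \<tau> + of_rat (q $ 2 $ 2) = 0"
  have "Im (of_rat (q $ 2 $ 1) * \<tau> + of_rat (q $ 2 $ 2)) = of_rat (q $ 2 $ 1) * Im \<tau>"
    by (simp add: complex_of_rat)
  with 0 assms(2) have "q $ 2 $ 1 = 0" by simp
  moreover with 0 have "q $ 2 $ 2 = 0" by simp
  ultimately have "det q = 0" by (simp add: det_2)
  with assms(1) show False by (simp add: invertible_det_nz)
qed

lemma moebius_mult:
  assumes "invertible p" "invertible q" "Im \<tau> \<noteq> 0"
  shows "moebius_act (p ** q) \<tau> = moebius_act p (moebius_act q \<tau>)"
proof -
  have "of_rat (q $ 2 $ 1) * \<tau> + of_rat (q $ 2 $ 2) \<noteq> 0"
    by (rule moebius_denominator[OF assms(2,3)])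
  then show ?thesis
    by (simp add: moebius_act_def matrix_mult_2 of_rat_add of_rat_mult divide_simps)
       (simp add: algebra_simps)
qed

lemma moebius_1 [simp]: "moebius_act (mat 1) \<tau> = \<tau>"
  by (simp add: moebius_act_def)

lemma Im_moebius:
  "Im (moebius_act q \<tau>) =
    of_rat (det q) * Im \<tau> / (cmod (of_rat (q $ 2 $ 1) * \<tau> + of_rat (q $ 2 $ 2)))\<^sup>2"
  by (simp add: moebius_act_def Im_divide cmod_power2 complex_of_rat det_2 of_rat_diff
      of_rat_mult algebra_simps)

lemma Im_moebius_nonzero:
  assumes "invertible q" "Im \<tau> \<noteq> 0"
  shows "Im (moebius_act q \<tau>) \<noteq> 0"
  using assms moebius_denominator[OF assms] by (simp add: Im_moebius invertible_det_nz)


section \<open>The Shimura variety\<close>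

definition shimura_rel :: "complex \<times> (adele^2^2) \<Rightarrow> complex \<times> (adele^2^2) \<Rightarrow> bool" where
  "shimura_rel s t \<longleftrightarrow> Im (fst s) \<noteq> 0 \<and> invertible (snd s) \<and>
     (\<exists>q. invertible q \<and> fst t = moebius_act q (fst s) \<and> snd t = adele_matrix q ** snd s)"

lemma shimura_relI:
  "Im \<tau> \<noteq> 0 \<Longrightarrow> invertible a \<Longrightarrow> invertible q \<Longrightarrow>
    shimura_rel (\<tau>, a) (moebius_act q \<tau>, adele_matrix q ** a)"
  by (auto simp: shimura_rel_def)

lemma shimura_rel_sym:
  assumes "shimura_rel s t"
  shows "shimura_rel t s"
proof -
  obtain \<tau> a where s: "s = (\<tau>, a)" by fastforce
  obtain q where q: "invertible q" "t = (moebius_act q \<tau>, adele_matrix q ** a)"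
    and Im: "Im \<tau> \<noteq> 0" and a: "invertible a"
    using assms by (auto simp: shimura_rel_def s prod_eq_iff)
  have inv: "invertible (matrix_inv q)" using q(1) by (rule invertible_matrix_inv)
  have "moebius_act (matrix_inv q) (moebius_act q \<tau>) = \<tau>"
    using moebius_mult[OF inv q(1) Im] q(1) by (simp add: matrix_inv_both)
  moreover have "adele_matrix (matrix_inv q) ** (adele_matrix q ** a) = a"
    using q(1) by (simp add: matrix_mul_assoc adele_matrix_mult[symmetric] matrix_inv_both)
  ultimately show ?thesis
    using shimura_relI[OF Im_moebius_nonzero[OF q(1) Im]
        invertible_mult[OF invertible_adele_matrix[OF q(1)] a] inv]
    by (simp add: s q(2))
qed

lemma shimura_rel_trans:
  assumes "shimura_rel s t" "shimura_rel t u"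
  shows "shimura_rel s u"
proof -
  obtain \<tau> a where s: "s = (\<tau>, a)" by fastforce
  obtain q where q: "invertible q" "t = (moebius_act q \<tau>, adele_matrix q ** a)"
    and Im: "Im \<tau> \<noteq> 0" and a: "invertible a"
    using assms(1) by (auto simp: shimura_rel_def s prod_eq_iff)
  obtain p where p: "invertible p" "u = (moebius_act p (moebius_act q \<tau>), adele_matrix p ** (adele_matrix q ** a))"
    using assms(2) by (auto simp: shimura_rel_def q(2) prod_eq_iff)
  show ?thesis
    using shimura_relI[OF Im a invertible_mult[OF p(1) q(1)]]
    by (simp add: s p(2) moebius_mult[OF p(1) q(1) Im] adele_matrix_mult matrix_mul_assoc)
qed

lemma part_equivp_shimura_rel: "part_equivp shimura_rel"
proof (rule part_equivpI)
  show "\<exists>s. shimura_rel s s"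
    using shimura_relI[of \<i> "mat 1" "mat 1"] by (auto simp: invertible_def)
  show "symp shimura_rel" by (simp add: symp_def shimura_rel_sym)
  show "transp shimura_rel" by (rule transpI) (rule shimura_rel_trans)
qed

quotient_type shimura = "complex \<times> (adele^2^2)" / partial: shimura_rel
  by (rule part_equivp_shimura_rel)

text \<open>
  The class \<open>[\<tau>, a]\<close>; it is meaningful for non-real \<open>\<tau>\<close> and invertible \<open>a\<close>, and every use below is
  guarded accordingly.
\<close>

lift_definition pt :: "complex \<Rightarrow> adele^2^2 \<Rightarrow> shimura"
  is "\<lambda>\<tau> a. if Im \<tau> \<noteq> 0 \<and> invertible a then (\<tau>, a) else (\<i>, mat 1)"
  using shimura_relI[where q = "mat 1"] by (auto simp: invertible_def)

lemma pt_cases [cases type: shimura]: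
  obtains (pt) \<tau> a where "s = pt \<tau> a" "Im \<tau> \<noteq> 0" "invertible a"
  by transfer (auto simp: shimura_rel_def)

lemma pt_eq_iff:
  assumes "Im \<tau> \<noteq> 0" "invertible a" "Im \<tau>' \<noteq> 0" "invertible a'"
  shows "pt \<tau> a = pt \<tau>' a' \<longleftrightarrow>
    (\<exists>q. invertible q \<and> \<tau>' = moebius_act q \<tau> \<and> a' = adele_matrix q ** a)"
  using assms by transfer (simp add: shimura_rel_def)

text \<open>
  The action \<open>g * [\<tau>, a] = [\<tau>, a g\<^sup>-\<^sup>1]\<close>, extended by the identity to matrices that are not invertible.
\<close>

lift_definition act :: "adele^2^2 \<Rightarrow> shimura \<Rightarrow> shimura"
  is "\<lambda>g (\<tau>, a). (\<tau>, if invertible g then a ** matrix_inv g else a)"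
proof -
  fix g :: "adele^2^2" and s t
  assume 1: "shimura_rel s t"
  obtain \<tau> a where s: "s = (\<tau>, a)" by fastforce
  obtain q where q: "invertible q" "t = (moebius_act q \<tau>, adele_matrix q ** a)"
    and Im: "Im \<tau> \<noteq> 0" and a: "invertible a"
    using 1 by (auto simp: shimura_rel_def s prod_eq_iff)
  show "shimura_rel (case s of (\<tau>, a) \<Rightarrow> (\<tau>, if invertible g then a ** matrix_inv g else a))
          (case t of (\<tau>, a) \<Rightarrow> (\<tau>, if invertible g then a ** matrix_inv g else a))"
  proof (cases "invertible g")
    case True
    then have "invertible (a ** matrix_inv g)"
      using a by (intro invertible_mult invertible_matrix_inv)
    from shimura_relI[OF Im this q(1)] True show ?thesis
      by (simp add: s q(2) matrix_mul_assoc)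
  next
    case False
    then show ?thesis using 1 by (simp add: s q(2))
  qed
qed

lemma act_pt:
  assumes "Im \<tau> \<noteq> 0" "invertible a" "invertible g"
  shows "act g (pt \<tau> a) = pt \<tau> (a ** matrix_inv g)"
proof -
  have inv: "invertible (a ** matrix_inv g)"
    using assms by (intro invertible_mult invertible_matrix_inv)
  show ?thesis
    using assms inv shimura_relI[OF assms(1) inv, of "mat 1"]
    by transfer (auto simp: invertible_def)
qed

lemma act_mult:
  assumes "invertible g" "invertible h"
  shows "act (g ** h) s = act g (act h s)"
  by (cases s) (simp add: assms act_pt invertible_mult invertible_matrix_inv matrix_inv_mult matrix_mul_assoc)

lemma act_1 [simp]: "act (mat 1) s = s"
proof -
  have 1: "invertible (mat 1 :: adele^2^2)" "matrix_inv (mat 1 :: adele^2^2) = mat 1"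
    by (auto simp: invertible_def intro: matrix_inv_unique_ring)
  show ?thesis by (cases s) (simp add: act_pt 1)
qed

lifting_forget shimura.lifting

definition component :: "adele \<Rightarrow> shimura set" where
  "component \<mu> = {pt \<tau> a | \<tau> a. 0 < Im \<tau> \<and> invertible a \<and> (\<exists>q\<in>Q_pos. det a = q * \<mu>)}"

definition same_component :: "shimura \<Rightarrow> shimura \<Rightarrow> bool" where
  "same_component s t \<longleftrightarrow> (\<exists>\<mu>\<in>Zhat_units. s \<in> component \<mu> \<and> t \<in> component \<mu>)"

definition imaginary_quadratic :: "complex \<Rightarrow> bool" where
  "imaginary_quadratic \<tau> \<longleftrightarrow> Im \<tau> \<noteq> 0 \<and>
     (\<exists>a b c :: rat. a \<noteq> 0 \<and> of_rat a * \<tau>\<^sup>2 + of_rat b * \<tau> + of_rat c = 0)"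

definition CM :: "shimura set" where
  "CM = {pt \<tau> a | \<tau> a. imaginary_quadratic \<tau> \<and> invertible a}"

text \<open>
  The automorphisms of the pure structure on a set \<open>X\<close> of points, which is \<open>UNIV\<close> or \<open>CM\<close>.
  The quotients by the groups \<open>K(N)\<close> impose no further condition, since a map commuting with all
  \<open>g\<close> respects the orbits of every subgroup.
\<close>

definition Aut_Pure :: "shimura set \<Rightarrow> (shimura \<Rightarrow> shimura) set" where
  "Aut_Pure X = {F \<in> Bij X.
     (\<forall>g. invertible g \<longrightarrow> (\<forall>s\<in>X. F (act g s) = act g (F s))) \<and>
     (\<forall>s\<in>X. \<forall>t\<in>X. same_component s t \<longleftrightarrow> same_component (F s) (F t))}"


section \<open>The quotient by the torus of unit diagonal matrices\<close>

definition Delta_rel :: "shimura \<Rightarrow> shimura \<Rightarrow> bool" where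
  "Delta_rel s t \<longleftrightarrow> (\<exists>u\<in>Zhat_units. t = act (diag_matrix u) s)"

lemma Zhat_1: "1 \<in> Zhat"
  by (auto simp: Zhat_def one_adele_frac)

lemma Zhat_mult: "x \<in> Zhat \<Longrightarrow> y \<in> Zhat \<Longrightarrow> x * y \<in> Zhat"
  by (auto simp: Zhat_def mult_adele_frac)

lemma Zhat_units_inverse:
  assumes "u \<in> Zhat_units"
  obtains v where "v \<in> Zhat_units" "u * v = 1"
  using assms by (auto simp: Zhat_units_def mult.commute)

lemma Zhat_units_mult:
  assumes "u \<in> Zhat_units" "v \<in> Zhat_units"
  shows "u * v \<in> Zhat_units"
proof -
  obtain u' v' where "u' \<in> Zhat" "v' \<in> Zhat" "u * u' = 1" "v * v' = 1" "u \<in> Zhat" "v \<in> Zhat"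
    using assms by (auto simp: Zhat_units_def)
  moreover from this have "(u * v) * (u' * v') = 1"
    by (metis mult.assoc mult.commute mult.right_neutral)
  ultimately show ?thesis by (auto simp: Zhat_units_def intro!: Zhat_mult)
qed

lemma invertible_diag_matrix:
  assumes "u \<in> Zhat_units"
  shows "invertible (diag_matrix u)"
proof -
  obtain v where "u * v = 1" using Zhat_units_inverse[OF assms] by blast
  then have "diag_matrix u ** diag_matrix v = mat 1" "diag_matrix v ** diag_matrix u = mat 1"
    by (simp_all add: diag_matrix_mult[symmetric] mult.commute)
  then show ?thesis by (auto simp: invertible_def)
qed

lemma equivp_Delta_rel: "equivp Delta_rel"
proof (rule equivpI)
  have "1 \<in> Zhat_units" using Zhat_1 by (auto simp: Zhat_units_def)
  then show "reflp Delta_rel"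
    unfolding reflp_def Delta_rel_def by (metis diag_matrix_1 act_1)
  show "symp Delta_rel"
  proof (rule sympI)
    fix s t assume "Delta_rel s t"
    then obtain u where u: "u \<in> Zhat_units" "t = act (diag_matrix u) s"
      by (auto simp: Delta_rel_def)
    then obtain v where v: "v \<in> Zhat_units" "u * v = 1" using Zhat_units_inverse by blast
    have "act (diag_matrix v) t = act (diag_matrix (v * u)) s"
      using u v by (simp add: diag_matrix_mult act_mult invertible_diag_matrix)
    then have "s = act (diag_matrix v) t" using v by (simp add: mult.commute)
    then show "Delta_rel t s" using v by (auto simp: Delta_rel_def)
  qed
  show "transp Delta_rel"
  proof (rule transpI)
    fix r s t assume "Delta_rel r s" "Delta_rel s t"
    then obtain u v where "u \<in> Zhat_units" "s = act (diag_matrix u) r"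
      "v \<in> Zhat_units" "t = act (diag_matrix v) s"
      by (auto simp: Delta_rel_def)
    then have "t = act (diag_matrix (v * u)) r" "v * u \<in> Zhat_units"
      by (simp_all add: diag_matrix_mult act_mult invertible_diag_matrix Zhat_units_mult)
    then show "Delta_rel r t" by (auto simp: Delta_rel_def)
  qed
qed

quotient_type shimura_approx = shimura / Delta_rel
  by (rule equivp_Delta_rel)

lift_definition approx :: "shimura \<Rightarrow> shimura_approx" is "\<lambda>s. s" .

definition induces :: "shimura set \<Rightarrow> (shimura \<Rightarrow> shimura) \<Rightarrow> (shimura_approx \<Rightarrow> shimura_approx) \<Rightarrow> bool" where
  "induces X F f \<longleftrightarrow> (\<forall>s\<in>X. f (approx s) = approx (F s))"

text \<open>
  The structure on the quotient is by definition the one whose automorphisms are the maps induced by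
  the automorphisms of the pure structure upstairs.
\<close>

definition Aut_Pure_approx :: "shimura set \<Rightarrow> (shimura_approx \<Rightarrow> shimura_approx) set" where
  "Aut_Pure_approx X = {f \<in> Bij (approx ` X). \<exists>F\<in>Aut_Pure X. induces X F f}"

definition canonical :: "complex \<Rightarrow> adele^2^2 \<Rightarrow> bool" where
  "canonical \<tau> a \<longleftrightarrow> 0 < Im \<tau> \<and> invertible a \<and> det a \<in> Q_pos"

definition pt_approx :: "complex \<Rightarrow> adele^2^2 \<Rightarrow> shimura_approx" where
  "pt_approx \<tau> a = approx (pt \<tau> a)"


section \<open>The structure on the projective limit of modular curves\<close>

definition G_tilde :: "(adele^2^2) set" where
  "G_tilde = {diag_matrix q ** g | q g. q \<in> Q_pos \<and> det g = 1}"

definition G_tilde_group :: "(adele^2^2) monoid" where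
  "G_tilde_group = \<lparr>carrier = G_tilde, mult = (**), one = mat 1\<rparr>"

definition Gamma_tilde :: "nat \<Rightarrow> (adele^2^2) set" where
  "Gamma_tilde N = {g. det g = 1 \<and> (\<forall>i j. g $ i $ j \<in> Zhat) \<and>
     (\<forall>i j. \<exists>z\<in>Zhat. g $ i $ j - mat 1 $ i $ j = of_nat N * z)}"

definition Delta_class :: "adele^2^2 \<Rightarrow> (adele^2^2) set" where
  "Delta_class g = {matrix_inv (diag_matrix u) ** g ** diag_matrix u | u. u \<in> Zhat_units}"

text \<open>
  The action of \<open>G_tilde\<close>, computed on a canonical representative; the result does not depend on
  which one is taken, see \<open>act_approx_pt\<close> below.
\<close>

definition act_approx :: "adele^2^2 \<Rightarrow> shimura_approx \<Rightarrow> shimura_approx" where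
  "act_approx g s = (THE t. \<exists>\<tau> a. canonical \<tau> a \<and> s = pt_approx \<tau> a \<and> t = pt_approx \<tau> (a ** matrix_inv g))"

lemma adele_of_rat_minus: "adele_of_rat (- p) = - adele_of_rat p"
  using adele_of_rat_add[of p "- p"] by (simp add: add_eq_0_iff)

lemma det_adele_matrix: "det (adele_matrix q) = adele_of_rat (det q)"
  using adele_of_rat_add[of "q$1$1 * q$2$2" "- (q$1$2 * q$2$1)"]
  by (simp add: det_2 adele_matrix_def adele_of_rat_mult adele_of_rat_minus)

lemma det_diag_matrix [simp]: "det (diag_matrix u :: 'a::comm_ring_1^2^2) = u"
  by (simp add: det_2 diag_matrix_def)

lemma adele_of_rat_in_Zhat:
  assumes "adele_of_rat r \<in> Zhat"
  shows "r \<in> \<int>"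
proof (cases r)
  case (Fract a b)
  obtain x where "adele_frac (of_int a) (nat b) = adele_frac x 1"
    using assms Fract by (auto simp: Zhat_def adele_of_rat_Fract)
  then have x: "of_int a = x * of_nat (nat b)"
    using Fract by (simp add: adele_frac_eq_iff)
  have "Rep_zhat (of_int a) (nat b) = a mod b"
  proof (cases a)
    case (nonneg n)
    then show ?thesis using Fract by (simp add: Rep_zhat_of_nat residue_family_def)
  next
    case (neg n)
    then have "(of_int a :: zhat) = - of_nat (Suc n)" by simp
    then show ?thesis using Fract neg
      by (simp only: uminus_zhat.rep_eq Rep_zhat_of_nat) (simp add: residue_family_def mod_minus_eq)
  qed
  moreover have "Rep_zhat (x * of_nat (nat b)) (nat b) = 0"
    using Fract by (simp add: times_zhat.rep_eq Rep_zhat_of_nat residue_family_def del: of_nat_nat)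
  ultimately have "b dvd a" using x by (simp add: dvd_eq_mod_eq_0)
  then show ?thesis using Fract by (auto simp: Fract_of_int_quotient elim!: dvdE)
qed

lemma adele_of_rat_unit:
  assumes "adele_of_rat r \<in> Zhat_units" "0 < r"
  shows "r = 1"
proof -
  obtain v where v: "v \<in> Zhat" "adele_of_rat r * v = 1"
    using assms(1) by (auto simp: Zhat_units_def)
  have inv: "adele_of_rat (1 / r) * adele_of_rat r = 1"
    using assms(2) by (simp add: adele_of_rat_mult[symmetric])
  have "v = (adele_of_rat (1 / r) * adele_of_rat r) * v" by (simp add: inv)
  also have "\<dots> = adele_of_rat (1 / r)" using v(2) by (simp add: mult.assoc)
  finally have "1 / r \<in> \<int>" using v(1) adele_of_rat_in_Zhat by simp
  moreover have "r \<in> \<int>" using assms(1) adele_of_rat_in_Zhat by (simp add: Zhat_units_def)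
  ultimately obtain m n :: int where "r = of_int m" "1 / r = of_int n" by (auto elim!: Ints_cases)
  then have "of_int (m * n) = (of_int 1 :: rat)" "0 < m" using assms(2) by (auto simp: field_simps)
  then have "m * n = 1" by (simp only: of_int_eq_iff)
  then have "m = 1" using \<open>0 < m\<close> by (simp add: pos_zmult_eq_1_iff)
  then show ?thesis using \<open>r = of_int m\<close> by simp
qed

lemma act_approx_pt:
  assumes can: "canonical \<tau> a" and g: "invertible g"
  shows "act_approx g (pt_approx \<tau> a) = pt_approx \<tau> (a ** matrix_inv g)"
proof -
  have \<tau>: "0 < Im \<tau>" and a: "invertible a" using can by (auto simp: canonical_def)
  have "pt_approx \<tau>' (a' ** matrix_inv g) = pt_approx \<tau> (a ** matrix_inv g)"
    if can': "canonical \<tau>' a'" and eq: "pt_approx \<tau> a = pt_approx \<tau>' a'" for \<tau>' a'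
  proof -
    have \<tau>': "0 < Im \<tau>'" and a': "invertible a'" using can' by (auto simp: canonical_def)
    have "Delta_rel (pt \<tau> a) (pt \<tau>' a')"
      using eq unfolding pt_approx_def by transfer
    then obtain u where u: "u \<in> Zhat_units" "pt \<tau>' a' = act (diag_matrix u) (pt \<tau> a)"
      by (auto simp: Delta_rel_def)
    obtain v where v: "v \<in> Zhat_units" "u * v = 1" using Zhat_units_inverse[OF u(1)] by blast
    have "matrix_inv (diag_matrix u) = diag_matrix v"
      by (rule matrix_inv_unique_ring) (use v in \<open>simp_all add: diag_matrix_mult[symmetric] mult.commute\<close>)
    then have "pt \<tau> (a ** diag_matrix v) = pt \<tau>' a'"
      using u \<tau> a by (simp add: act_pt invertible_diag_matrix)
    then obtain q where q: "invertible q" "\<tau>' = moebius_act q \<tau>" "a' = adele_matrix q ** (a ** diag_matrix v)"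
      using pt_eq_iff[of \<tau> "a ** diag_matrix v" \<tau>' a'] \<tau> \<tau>' a a' v(1)
      by (auto simp: invertible_mult invertible_diag_matrix)
    have "0 < (of_rat (det q) :: real)"
      using \<tau> \<tau>' unfolding q(2) Im_moebius by (auto simp: zero_less_divide_iff zero_less_mult_iff)
    then have q_pos: "0 < det q" by simp
    obtain p p' where p: "0 < p" "0 < p'" "det a = adele_of_rat p" "det a' = adele_of_rat p'"
      using can can' by (auto simp: canonical_def Q_pos_def)
    then have "adele_of_rat p' = adele_of_rat (det q * p) * v"
      using arg_cong[OF q(3), of det]
      by (simp add: det_mul det_adele_matrix adele_of_rat_mult mult.assoc)
    then have "adele_of_rat (1 / (det q * p)) * adele_of_rat p'
        = (adele_of_rat (1 / (det q * p)) * adele_of_rat (det q * p)) * v"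
      by (simp add: mult.assoc)
    then have "adele_of_rat (p' / (det q * p)) = v"
      using p(1) q_pos by (simp add: adele_of_rat_mult[symmetric])
    moreover have "0 < p' / (det q * p)" using p q_pos by simp
    ultimately have "v = 1" using v(1) adele_of_rat_unit by fastforce
    then have eq': "a' ** matrix_inv g = adele_matrix q ** (a ** matrix_inv g)"
      using q(3) by (simp add: matrix_mul_assoc)
    have "invertible (a ** matrix_inv g)" "invertible (a' ** matrix_inv g)"
      using a a' g by (auto intro: invertible_mult invertible_matrix_inv)
    then have "pt \<tau> (a ** matrix_inv g) = pt \<tau>' (a' ** matrix_inv g)"
      using pt_eq_iff[of \<tau> "a ** matrix_inv g" \<tau>' "a' ** matrix_inv g"] \<tau> \<tau>' q(1,2) eq'
      by auto
    then show ?thesis by (simp add: pt_approx_def)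
  qed
  then show ?thesis unfolding act_approx_def using can by (intro the_equality) blast+
qed

definition stabiliser :: "complex \<Rightarrow> (rat^2^2) set" where
  "stabiliser \<tau> = {q. invertible q \<and> moebius_act q \<tau> = \<tau>}"

definition normaliser :: "complex \<Rightarrow> (adele^2^2) set" where
  "normaliser \<tau> = {w. invertible w \<and>
     (\<lambda>x. w ** x ** matrix_inv w) ` adele_matrix ` stabiliser \<tau> = adele_matrix ` stabiliser \<tau>}"

definition R_at :: "complex \<Rightarrow> complex \<Rightarrow>
    shimura_approx \<Rightarrow> shimura_approx \<Rightarrow> shimura_approx \<Rightarrow> shimura_approx \<Rightarrow> bool" where
  "R_at \<tau>1 \<tau>2 s1 s2 t1 t2 \<longleftrightarrow>
     (\<exists>a1 a2 b1 b2 r1 r2.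
        canonical \<tau>1 a1 \<and> canonical \<tau>2 a2 \<and> canonical \<tau>1 b1 \<and> canonical \<tau>2 b2 \<and>
        s1 = pt_approx \<tau>1 a1 \<and> s2 = pt_approx \<tau>2 a2 \<and>
        t1 = pt_approx \<tau>1 b1 \<and> t2 = pt_approx \<tau>2 b2 \<and>
        r1 \<in> normaliser \<tau>1 \<and> r2 \<in> normaliser \<tau>2 \<and> det r1 = det r2 \<and> det r1 \<in> Zhat_units \<and>
        b1 = r1 ** a1 ** matrix_inv (diag_matrix (det r1)) \<and>
        b2 = r2 ** a2 ** matrix_inv (diag_matrix (det r2)))"

definition R_rel :: "shimura_approx \<Rightarrow> shimura_approx \<Rightarrow> shimura_approx \<Rightarrow> shimura_approx \<Rightarrow> bool" where
  "R_rel s1 s2 t1 t2 \<longleftrightarrow>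
     (\<exists>m1 m2 :: nat. 0 < m1 \<and> 0 < m2 \<and> squarefree m1 \<and> squarefree m2 \<and>
        R_at (\<i> * of_real (sqrt (real m1))) (\<i> * of_real (sqrt (real m2))) s1 s2 t1 t2)"

text \<open>
  An automorphism of the two-sorted structure is a pair of a permutation of the points and an
  automorphism of the group. The sets \<open>Delta_class g\<close> and \<open>Gamma_tilde N\<close> are definable without
  parameters, so they are preserved. The sets \<open>{(t1, t2). R_rel s1 s2 t1 t2}\<close> are definable from the
  special points \<open>s1\<close>, \<open>s2\<close>, so the set attached to \<open>(s1, s2)\<close> is carried to the set attached to
  the images of \<open>s1\<close> and \<open>s2\<close>; as \<open>R_rel\<close> holds between special points only, this says that the
  quaternary relation \<open>R_rel\<close> is preserved.
\<close>

definition Aut_H_tilde :: "shimura set \<Rightarrow>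
    ((shimura_approx \<Rightarrow> shimura_approx) \<times> (adele^2^2 \<Rightarrow> adele^2^2)) set" where
  "Aut_H_tilde X = {(f, \<phi>). f \<in> Bij (approx ` X) \<and> \<phi> \<in> auto G_tilde_group \<and>
     (\<forall>g\<in>G_tilde. \<forall>s\<in>approx ` X. f (act_approx g s) = act_approx (\<phi> g) (f s)) \<and>
     (\<forall>g\<in>G_tilde. \<phi> ` Delta_class g = Delta_class g) \<and>
     (\<forall>N>0. \<phi> ` Gamma_tilde N = Gamma_tilde N) \<and>
     (\<forall>s1\<in>approx ` X. \<forall>s2\<in>approx ` X. \<forall>t1\<in>approx ` X. \<forall>t2\<in>approx ` X.
        R_rel s1 s2 t1 t2 \<longleftrightarrow> R_rel (f s1) (f s2) (f t1) (f t2))}"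

text \<open>
  The induced structure on \<open>shimura_approx\<close> is given by its automorphism group \<open>A\<close>.
  Its bi-interpretability with a structure having \<open>shimura_approx\<close> as one of its two sorts (and
  automorphism group \<open>B\<close>) is expressed through automorphisms: restriction to the common sort, which
  commutes with composition, identifies the two automorphism groups.
\<close>

definition bi_interpretable :: "('a \<Rightarrow> 'a) set \<Rightarrow> (('a \<Rightarrow> 'a) \<times> ('b \<Rightarrow> 'b)) set \<Rightarrow> bool" where
  "bi_interpretable A B \<longleftrightarrow> bij_betw fst B A"

end

theory Submission
  imports Defs
begin

text \<open>
  The set \<open>component 1\<close> is a section of the quotient map, and the unit diagonal matrices permute the
  components simply transitively, so a point is determined by its class and its component. An
  automorphism upstairs shifts all components by one fixed unit \<open>k\<close>; comparing representatives in
  \<open>component 1\<close>, the induced map is equivariant up to conjugation by \<open>diag_matrix k\<close>. It preserves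
  the relation \<open>R_rel\<close> because it maps \<open>[\<tau>, a]\<close> to \<open>[\<tau>, w a]\<close> with \<open>w\<close> in the normaliser, for each
  \<open>\<tau> = \<i> \<surd>m\<close>. Conversely, an automorphism of the group preserving the sets \<open>Delta_class g\<close> is
  conjugation by some \<open>diag_matrix k\<close>, and \<open>f\<close> lifts by moving the component \<open>u\<close> to the
  component \<open>k u\<close>.
\<close>

lemma unit_mult_shift:
  fixes a :: "'a::comm_ring_1"
  assumes "a * b = 1" "x = y * b"
  shows "y = a * x"
  using assms by (metis mult.assoc mult.commute mult.right_neutral)


subsection \<open>Invertible adeles\<close>

lemma compatible_Rep_zhat: "compatible (Rep_zhat x)"
  using Rep_zhat[of x] by simp

lemma zhat_eqI:
  assumes "\<And>N. 0 < N \<Longrightarrow> Rep_zhat x N = Rep_zhat y N"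
  shows "x = y"
proof (rule Rep_zhat_inject[THEN iffD1], rule ext)
  fix N show "Rep_zhat x N = Rep_zhat y N"
    using assms[of N] compatible_0[OF compatible_Rep_zhat] by (cases "N = 0") simp_all
qed

text \<open>The residue modulo \<open>N\<close> of the quotient is the integer quotient by
  \<open>M\<close> of the residue of \<open>x\<close> modulo \<open>M * N\<close>. Splitting a
  residue modulo \<open>M * L\<close> into quotient and remainder by \<open>M\<close> shows that
  these residues are compatible.\<close>

lemma zhat_dvdI:
  assumes M: "0 < M" and 0: "Rep_zhat x M = 0"
  shows "of_nat M dvd x"
proof -
  define f where "f N = Rep_zhat x (M * N) div int M" for N
  have eq: "f L mod int L = f N mod int L" if "0 < N" "L dvd N" for L N
  proof -
    have "Rep_zhat x (M * L) = Rep_zhat x (M * N) mod int (M * L)"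
      using that M by (intro compatible_dvd[OF compatible_Rep_zhat]) auto
    then have "f L = (Rep_zhat x (M * N) mod (int M * int L)) div int M"
      by (simp add: f_def)
    also have "\<dots> = (int M * (Rep_zhat x (M * N) div int M mod int L) + Rep_zhat x (M * N) mod int M) div int M"
      by (simp add: zmod_zmult2_eq)
    also have "\<dots> = f N mod int L"
      using M by (simp add: f_def)
    finally show ?thesis by simp
  qed
  define z where "z = Abs_zhat (residue_family f)"
  have z: "Rep_zhat z = residue_family f"
    unfolding z_def by (rule Abs_zhat_inverse) (simp add: compatible_residue_family[OF eq])
  have "x = of_nat M * z"
  proof (rule zhat_eqI)
    fix N :: nat assume N: "0 < N"
    have "Rep_zhat x (M * N) mod int M = 0"
      using compatible_dvd[OF compatible_Rep_zhat, of "M * N" M x] M N 0 by simp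
    then have "int M * f N = Rep_zhat x (M * N)" by (auto simp: f_def)
    moreover have "Rep_zhat x N = Rep_zhat x (M * N) mod int N"
      using N M by (intro compatible_dvd[OF compatible_Rep_zhat]) auto
    ultimately show "Rep_zhat x N = Rep_zhat (of_nat M * z) N"
      using N by (simp add: times_zhat.rep_eq Rep_zhat_of_nat z residue_family_def mod_mult_eq)
  qed
  then show ?thesis by simp
qed

text \<open>Both \<open>x\<close> and the greatest common divisor of \<open>M\<close> with the residue of \<open>x\<close> modulo \<open>M\<close>
  generate the ideal \<open>(x, M)\<close>.\<close>

lemma zhat_dvd_of_nat:
  fixes x :: zhat
  assumes xy: "x * y = of_nat M" and M: "0 < M"
  obtains d u v where "0 < d" "x = of_nat d * u" "u * v = 1"
proof -
  define n where "n = nat (Rep_zhat x M)"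
  have "Rep_zhat x M = Rep_zhat x M mod int M"
    using compatible_dvd[OF compatible_Rep_zhat M dvd_refl] by simp
  then have "0 \<le> Rep_zhat x M" using M by (metis of_nat_0_less_iff pos_mod_sign)
  then have n: "Rep_zhat x M = int n" by (simp add: n_def)
  have "Rep_zhat (x - of_nat n) M = 0"
    using M by (simp add: minus_zhat.rep_eq Rep_zhat_of_nat residue_family_def mod_simps n)
  then obtain z where z: "x - of_nat n = of_nat M * z"
    using zhat_dvdI[OF M] by (auto elim: dvdE)
  define d where "d = gcd n M"
  have d: "0 < d" using M by (simp add: d_def)
  obtain n' M' where n': "n = d * n'" and M': "M = d * M'"
    by (metis d_def dvdE gcd_dvd1 gcd_dvd2)
  define u where "u = of_nat n' + of_nat M' * z"
  have x: "x = of_nat d * u"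
    using z by (simp add: u_def n' M' algebra_simps)
  obtain s t where "s * int n + t * int M = int d"
    using bezout_int[of "int n" "int M"] by (auto simp: d_def gcd_int_int_eq)
  then have "(of_int s * of_nat n + of_int t * of_nat M :: zhat) = of_nat d"
    by (metis of_int_add of_int_mult of_int_of_nat_eq)
  \<comment> \<open>As \<open>M\<close> is \<open>x * y\<close>, both \<open>n\<close> and
    \<open>M\<close> are multiples of \<open>x\<close>, so the Bezout relation makes
    \<open>d\<close> a multiple of \<open>x\<close>. Substituting \<open>x = of_nat d * u\<close>
    and cancelling \<open>d\<close> leaves an inverse of \<open>u\<close>.\<close>
  moreover have "of_nat n = x * (1 - y * z)"
    using z by (simp add: algebra_simps flip: xy)
  ultimately have "of_nat d = x * (of_int s * (1 - y * z) + of_int t * y)"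
    by (simp add: algebra_simps flip: xy)
  then have "of_nat d * (u * (of_int s * (1 - y * z) + of_int t * y)) = of_nat d * 1"
    using x by (simp add: mult.assoc)
  then have "u * (of_int s * (1 - y * z) + of_int t * y) = 1"
    using d by (rule zhat_cancel)
  with d x show ?thesis by (rule that)
qed

text \<open>The numerator of an invertible fraction divides a positive integer, the product of the
  two denominators, so it is a positive integer times a unit. For finite ideles this expresses that
  the rationals have class number one.\<close>

lemma adele_unit_decomposition:
  assumes "a * b = (1 :: adele)"
  obtains q u where "q \<in> Q_pos" "u \<in> Zhat_units" "a = q * u"
proof -
  obtain x m y n where a: "a = adele_frac x m" "0 < m" and b: "b = adele_frac y n" "0 < n"
    by (metis adele_cases)
  have "x * y = of_nat (m * n)"
    using assms a b by (simp add: mult_adele_frac one_adele_frac adele_frac_eq_iff)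
  then obtain d u v where d: "0 < d" "x = of_nat d * u" "u * v = 1"
    using zhat_dvd_of_nat a(2) b(2) by (metis nat_0_less_mult_iff)
  have "a = adele_of_rat (Fract (int d) (int m)) * adele_frac u 1"
    using a d by (simp add: adele_of_rat_Fract mult_adele_frac adele_frac_eq_iff)
  moreover have "adele_of_rat (Fract (int d) (int m)) \<in> Q_pos"
    using a(2) d(1) by (auto simp: Q_pos_def zero_less_Fract_iff)
  moreover have "adele_frac u 1 * adele_frac v 1 = 1"
    using d(3) by (simp add: mult_adele_frac one_adele_frac)
  then have "adele_frac u 1 \<in> Zhat_units" by (auto simp: Zhat_units_def Zhat_def)
  ultimately show ?thesis using that by blast
qed

lemma Q_pos_1: "1 \<in> Q_pos"
  unfolding Q_pos_def by (rule image_eqI[of _ _ 1]) simp_all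

lemma Q_pos_mult: "p \<in> Q_pos \<Longrightarrow> q \<in> Q_pos \<Longrightarrow> p * q \<in> Q_pos"
  unfolding Q_pos_def by (auto simp: adele_of_rat_mult[symmetric])

lemma Q_pos_inverse:
  assumes "q \<in> Q_pos"
  obtains p where "p \<in> Q_pos" "q * p = 1"
proof -
  obtain r where r: "0 < r" "q = adele_of_rat r" using assms by (auto simp: Q_pos_def)
  then have "q * adele_of_rat (1 / r) = 1" by (simp add: adele_of_rat_mult[symmetric])
  moreover have "adele_of_rat (1 / r) \<in> Q_pos" using r by (simp add: Q_pos_def)
  ultimately show ?thesis using that by blast
qed

lemma Zhat_units_1: "1 \<in> Zhat_units"
  using Zhat_1 by (auto simp: Zhat_units_def)

lemma Zhat_unitsD: "u \<in> Zhat_units \<Longrightarrow> u \<in> Zhat"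
  by (simp add: Zhat_units_def)

text \<open>The quotient of \<open>u\<close> by \<open>v\<close> is both a positive rational and a
  profinite unit, hence one. So the factorisation of \<open>adele_unit_decomposition\<close> is
  unique.\<close>

lemma Q_pos_times_unit_eq:
  assumes "p * u = q * v" "p \<in> Q_pos" "q \<in> Q_pos" "u \<in> Zhat_units" "v \<in> Zhat_units"
  shows "u = v"
proof -
  obtain p' where p': "p' \<in> Q_pos" "p * p' = 1" using Q_pos_inverse[OF assms(2)] .
  obtain v' where v': "v' \<in> Zhat_units" "v * v' = 1" using Zhat_units_inverse[OF assms(5)] .
  have "(p * p') * (u * v') = (p' * q) * (v * v')"
    using assms(1) by (metis mult.assoc mult.commute)
  then have eq: "u * v' = p' * q" using p' v' by simp
  have "p' * q \<in> Q_pos" "u * v' \<in> Zhat_units"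
    using assms p' v' by (auto intro: Q_pos_mult Zhat_units_mult)
  with eq have "u * v' = 1"
    unfolding Q_pos_def using adele_of_rat_unit by fastforce
  then show ?thesis using v'(2) by (metis mult.assoc mult.commute mult.right_neutral)
qed


subsection \<open>Matrices of adeles\<close>

text \<open>The adjugate matrix scaled by \<open>e\<close> is a two-sided inverse.\<close>

lemma invertible_2I:
  fixes a :: "'a::comm_ring_1^2^2"
  assumes "det a * e = 1"
  shows "invertible a"
proof -
  define b :: "'a^2^2" where
    "b = vector [vector [e * a$2$2, - (e * a$1$2)], vector [- (e * a$2$1), e * a$1$1]]"
  have "e * a$1$1 * a$2$2 - e * a$1$2 * a$2$1 = 1"
    using assms by (simp add: det_2 algebra_simps)
  then have "a ** b = mat 1" "b ** a = mat 1"
    by (simp_all add: b_def matrix_eq_2 matrix_mult_2 algebra_simps)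
  then show ?thesis by (auto simp: invertible_def)
qed

lemma invertible_det_adele:
  assumes "invertible (a :: adele^2^2)"
  obtains e where "det a * e = 1"
  using assms unfolding invertible_def by (metis det_I det_mul)

lemma invertible_Q_pos: "det a \<in> Q_pos \<Longrightarrow> invertible (a :: adele^2^2)"
  by (metis Q_pos_inverse invertible_2I)

lemma matrix_inv_diag_matrix:
  fixes u :: "'a::comm_ring_1"
  assumes "u * v = 1"
  shows "matrix_inv (diag_matrix u) = diag_matrix v"
  by (rule matrix_inv_unique_ring)
     (use assms in \<open>simp_all add: diag_matrix_mult[symmetric] mult.commute\<close>)

lemma diag_matrix_nth [simp]:
  "diag_matrix u $ 1 $ 1 = u" "diag_matrix u $ 1 $ 2 = 0"
  "diag_matrix u $ 2 $ 1 = 0" "diag_matrix u $ 2 $ 2 = 1"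
  by (simp_all add: diag_matrix_def)

text \<open>Splitting off \<open>diag_matrix (det g)\<close> leaves a matrix of determinant
  one.\<close>

lemma G_tilde_iff: "g \<in> G_tilde \<longleftrightarrow> det g \<in> Q_pos"
proof
  assume "g \<in> G_tilde"
  then show "det g \<in> Q_pos" by (auto simp: G_tilde_def det_mul)
next
  assume *: "det g \<in> Q_pos"
  then obtain p where p: "det g * p = 1" using Q_pos_inverse by blast
  have "g = diag_matrix (det g) ** (diag_matrix p ** g)"
    using p by (simp add: matrix_mul_assoc diag_matrix_mult[symmetric])
  moreover have "det (diag_matrix p ** g) = 1" using p by (simp add: det_mul mult.commute)
  ultimately show "g \<in> G_tilde" using * by (auto simp: G_tilde_def)
qed

lemma G_tilde_invertible: "g \<in> G_tilde \<Longrightarrow> invertible g"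
  using G_tilde_iff invertible_Q_pos by blast

lemma adele_of_rat_eq_0:
  assumes "adele_of_rat r = 0"
  shows "r = 0"
proof (rule ccontr)
  assume "r \<noteq> 0"
  then have "adele_of_rat r * adele_of_rat (1 / r) = 1" by (simp add: adele_of_rat_mult[symmetric])
  then show False using assms by simp
qed

lemma adele_of_rat_inject [simp]: "adele_of_rat p = adele_of_rat q \<longleftrightarrow> p = q"
  using adele_of_rat_eq_0[of "p - q"] adele_of_rat_add[of p "- q"] adele_of_rat_minus[of q] by auto


lemma diag_matrix_commute: "diag_matrix u ** diag_matrix v = diag_matrix v ** diag_matrix (u :: 'a::comm_ring_1)"
  by (simp add: diag_matrix_mult[symmetric] mult.commute)

lemma matrix_mul_cancel:
  fixes a b :: "'a::semiring_1^2^2"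
  assumes "invertible a"
  shows "matrix_inv a ** (a ** b) = b" "a ** (matrix_inv a ** b) = b"
    "b ** matrix_inv a ** a = b" "b ** a ** matrix_inv a = b"
  using assms by (simp_all add: matrix_mul_assoc matrix_inv_both)
     (simp_all add: matrix_mul_assoc[symmetric] matrix_inv_both)

lemma matrix_inv_involutive:
  fixes a :: "'a::semiring_1^2^2"
  shows "invertible a \<Longrightarrow> matrix_inv (matrix_inv a) = a"
  by (intro matrix_inv_unique_ring matrix_inv_both)


subsection \<open>Components\<close>

lemma act_diag_inverse:
  assumes "u \<in> Zhat_units" "v \<in> Zhat_units" "u * v = 1"
  shows "act (diag_matrix u) (act (diag_matrix v) s) = s"
  using assms by (simp add: act_mult[symmetric] invertible_diag_matrix diag_matrix_mult[symmetric])

text \<open>The rational matrix \<open>diag_matrix (- 1)\<close> acts by negation and so exchanges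
  the two half-planes.\<close>

lemma pt_upper_cases:
  obtains \<tau> a where "s = pt \<tau> a" "0 < Im \<tau>" "invertible a"
proof -
  obtain \<tau> a where s: "s = pt \<tau> a" "Im \<tau> \<noteq> 0" "invertible a" by (cases s)
  show ?thesis
  proof (cases "0 < Im \<tau>")
    case True
    with s that show ?thesis by blast
  next
    case False
    define q :: "rat^2^2" where "q = diag_matrix (- 1)"
    have q: "invertible q" by (simp add: q_def invertible_det_nz)
    have "moebius_act q \<tau> = - \<tau>" by (simp add: moebius_act_def q_def)
    moreover have "pt \<tau> a = pt (moebius_act q \<tau>) (adele_matrix q ** a)"
      using s q by (subst pt_eq_iff)
        (auto simp: Im_moebius_nonzero invertible_mult invertible_adele_matrix)
    ultimately show ?thesis
      using that[of "- \<tau>" "adele_matrix q ** a"] s q False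
      by (simp add: invertible_mult invertible_adele_matrix)
  qed
qed

text \<open>Two representatives over the upper half-plane differ by a rational matrix of positive
  determinant, which changes \<open>det a\<close> by a factor in \<open>Q_pos\<close> only. Hence
  any one representative decides membership.\<close>

lemma pt_mem_component_iff:
  assumes "0 < Im \<tau>" "invertible a"
  shows "pt \<tau> a \<in> component \<mu> \<longleftrightarrow> (\<exists>q\<in>Q_pos. det a = q * \<mu>)"
proof
  assume "pt \<tau> a \<in> component \<mu>"
  then obtain \<tau>' a' q where *: "pt \<tau>' a' = pt \<tau> a" "0 < Im \<tau>'" "invertible a'" "q \<in> Q_pos" "det a' = q * \<mu>"
    unfolding component_def by fastforce
  then obtain p where p: "invertible p" "\<tau> = moebius_act p \<tau>'" "a = adele_matrix p ** a'"
    using pt_eq_iff[of \<tau>' a' \<tau> a] assms by auto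
  have "0 < (of_rat (det p) :: real)"
    using *(2) assms(1) unfolding p(2) Im_moebius by (auto simp: zero_less_divide_iff zero_less_mult_iff)
  then have "adele_of_rat (det p) \<in> Q_pos" by (simp add: Q_pos_def)
  moreover have "det a = (adele_of_rat (det p) * q) * \<mu>"
    by (simp add: p(3) det_mul det_adele_matrix *(5) mult.assoc)
  ultimately show "\<exists>q\<in>Q_pos. det a = q * \<mu>" using *(4) Q_pos_mult by blast
next
  assume "\<exists>q\<in>Q_pos. det a = q * \<mu>"
  then show "pt \<tau> a \<in> component \<mu>" using assms by (auto simp: component_def)
qed

lemma pt_mem_component_1_iff:
  assumes "0 < Im \<tau>" "invertible a"
  shows "pt \<tau> a \<in> component 1 \<longleftrightarrow> canonical \<tau> a"
  using assms by (auto simp: pt_mem_component_iff canonical_def)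

lemma component_cover:
  obtains u where "u \<in> Zhat_units" "s \<in> component u"
proof -
  obtain \<tau> a where s: "s = pt \<tau> a" "0 < Im \<tau>" "invertible a" by (rule pt_upper_cases)
  obtain e where "det a * e = 1" using invertible_det_adele[OF s(3)] .
  then obtain q u where "q \<in> Q_pos" "u \<in> Zhat_units" "det a = q * u"
    by (rule adele_unit_decomposition)
  then show ?thesis using that s by (auto simp: pt_mem_component_iff)
qed

lemma component_unique:
  assumes "s \<in> component u" "s \<in> component v" "u \<in> Zhat_units" "v \<in> Zhat_units"
  shows "u = v"
proof -
  obtain \<tau> a where s: "s = pt \<tau> a" "0 < Im \<tau>" "invertible a" by (rule pt_upper_cases)
  then show ?thesis
    using assms by (auto simp: pt_mem_component_iff) (metis Q_pos_times_unit_eq)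
qed

lemma same_componentD:
  assumes "same_component s t" "s \<in> component u" "u \<in> Zhat_units"
  shows "t \<in> component u"
  using assms component_unique unfolding same_component_def by blast

text \<open>The action divides the determinant of a representative by \<open>det g\<close>. The
  rational part \<open>q\<close> is absorbed into \<open>Q_pos\<close>, so the index of the
  component is divided by the unit part \<open>v\<close>, whose inverse is
  \<open>v'\<close>.\<close>

lemma act_mem_component:
  assumes s: "s \<in> component u" and g: "invertible g" "det g = q * v" "q \<in> Q_pos" and v: "v * v' = 1"
  shows "act g s \<in> component (u * v')"
proof -
  obtain \<tau> a p where a: "s = pt \<tau> a" "0 < Im \<tau>" "invertible a" "p \<in> Q_pos" "det a = p * u"
    using s unfolding component_def by auto
  obtain q' where q': "q' \<in> Q_pos" "q * q' = 1" using Q_pos_inverse[OF g(3)] .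
  have 1: "det (matrix_inv g) * (q * v) = 1"
    using matrix_inv_both(2)[OF g(1)] g(2) by (metis det_I det_mul)
  have "det (matrix_inv g) = det (matrix_inv g) * ((q * q') * (v * v'))"
    using q' v by simp
  also have "\<dots> = (det (matrix_inv g) * (q * v)) * (q' * v')" by (simp add: ac_simps)
  finally have "det (matrix_inv g) = q' * v'" using 1 by simp
  then have "det (a ** matrix_inv g) = (p * q') * (u * v')"
    using a by (simp add: det_mul ac_simps)
  moreover have "act g s = pt \<tau> (a ** matrix_inv g)"
    using a g by (simp add: act_pt)
  ultimately show ?thesis
    using a g q' by (auto simp: pt_mem_component_iff invertible_mult invertible_matrix_inv Q_pos_mult)
qed

lemma act_diag_mem_component:
  assumes "s \<in> component u" "v \<in> Zhat_units" "v * v' = 1"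
  shows "act (diag_matrix v) s \<in> component (u * v')"
  using assms by (intro act_mem_component[where q = 1 and v = v])
    (auto simp: invertible_diag_matrix Q_pos_1)

lemma act_G_tilde_mem_component:
  assumes "s \<in> component u" "g \<in> G_tilde"
  shows "act g s \<in> component u"
  using act_mem_component[OF assms(1), of g "det g" 1 1] assms(2)
  by (simp add: G_tilde_iff invertible_Q_pos)


subsection \<open>The quotient\<close>

lemma approx_surj: obtains s where "y = approx s"
  using that by (metis Quotient3_def Quotient3_shimura_approx approx.abs_eq)

lemma approx_eq_iff: "approx s = approx t \<longleftrightarrow> Delta_rel s t"
  by transfer simp

lemma approx_act_diag: "u \<in> Zhat_units \<Longrightarrow> approx (act (diag_matrix u) s) = approx s"
  by (rule sym) (auto simp: approx_eq_iff Delta_rel_def)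

text \<open>Points of one class differ by some \<open>diag_matrix v\<close>, which divides the index
  of the component by \<open>v\<close>; staying in the same component forces
  \<open>v = 1\<close>.\<close>

lemma approx_inj_component:
  assumes "approx s = approx t" "s \<in> component u" "t \<in> component u" "u \<in> Zhat_units"
  shows "s = t"
proof -
  obtain v where v: "v \<in> Zhat_units" "t = act (diag_matrix v) s"
    using assms(1) by (auto simp: approx_eq_iff Delta_rel_def)
  obtain v' where v': "v' \<in> Zhat_units" "v * v' = 1" using Zhat_units_inverse[OF v(1)] .
  have "t \<in> component (u * v')" using act_diag_mem_component[OF assms(2) v(1) v'(2)] v by simp
  then have eq: "u * v' = u" using component_unique assms v' Zhat_units_mult by blast
  obtain u' where "u * u' = 1" using Zhat_units_inverse[OF assms(4)] by blast
  then have "v' = 1" using eq by (metis mult.assoc mult.commute mult.right_neutral)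
  then show ?thesis using v v' by simp
qed

text \<open>If \<open>s\<close> lies in \<open>component w\<close>, the diagonal matrix of the
  quotient of \<open>w\<close> by \<open>u\<close> moves it to \<open>component u\<close>.\<close>

lemma approx_fibre:
  assumes "u \<in> Zhat_units"
  obtains v where "v \<in> Zhat_units" "act (diag_matrix v) s \<in> component u"
proof -
  obtain w where w: "w \<in> Zhat_units" "s \<in> component w" by (rule component_cover)
  obtain w' where w': "w' \<in> Zhat_units" "w * w' = 1" using Zhat_units_inverse[OF w(1)] .
  obtain u' where u': "u' \<in> Zhat_units" "u * u' = 1" using Zhat_units_inverse[OF assms] .
  have "(w * u') * (u * w') = (w * w') * (u * u')" by (simp add: ac_simps)
  then have "act (diag_matrix (w * u')) s \<in> component (w * (u * w'))"
    using w w' u' by (intro act_diag_mem_component) (auto intro: Zhat_units_mult)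
  moreover have "w * (u * w') = (w * w') * u" by (simp add: ac_simps)
  ultimately show ?thesis using that[of "w * u'"] w w' u' by (simp add: Zhat_units_mult)
qed

text \<open>The points of \<open>component 1\<close> are those with a canonical representative, the
  only ones entering the definition of \<open>act_approx\<close>. In another component the two
  actions differ by a diagonal conjugation of \<open>g\<close>.\<close>

lemma act_approx_approx:
  assumes "s \<in> component 1" "g \<in> G_tilde"
  shows "act_approx g (approx s) = approx (act g s)"
proof -
  obtain \<tau> a where s: "s = pt \<tau> a" "0 < Im \<tau>" "invertible a" by (rule pt_upper_cases)
  then have "canonical \<tau> a" using assms(1) by (simp add: pt_mem_component_1_iff)
  then show ?thesis
    using act_approx_pt[of \<tau> a g] s assms(2) by (simp add: pt_approx_def act_pt G_tilde_invertible)
qed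


subsection \<open>Conjugation by diagonal matrices\<close>

text \<open>In \<open>conj_diag u v g\<close> the argument \<open>v\<close> is to be the inverse of \<open>u\<close>.\<close>

definition conj_diag :: "adele \<Rightarrow> adele \<Rightarrow> adele^2^2 \<Rightarrow> adele^2^2" where
  "conj_diag u v g = diag_matrix u ** g ** diag_matrix v"

lemma conj_diag_nth:
  assumes "u * v = 1"
  shows "conj_diag u v g $ 1 $ 1 = g $ 1 $ 1" "conj_diag u v g $ 1 $ 2 = u * g $ 1 $ 2"
    "conj_diag u v g $ 2 $ 1 = v * g $ 2 $ 1" "conj_diag u v g $ 2 $ 2 = g $ 2 $ 2"
proof -
  have "u * x * v = x" for x using assms by (metis mult.assoc mult.commute mult.right_neutral)
  then show "conj_diag u v g $ 1 $ 1 = g $ 1 $ 1" by (simp add: conj_diag_def matrix_mult_2)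
qed (simp_all add: conj_diag_def matrix_mult_2 mult.commute)

lemma conj_diag_conj_diag: "conj_diag u v (conj_diag u' v' g) = conj_diag (u * u') (v * v') g"
  by (simp add: conj_diag_def diag_matrix_mult matrix_mul_assoc)
    (metis (no_types, lifting) diag_matrix_commute matrix_mul_assoc)

lemma conj_diag_inverse: "u * v = 1 \<Longrightarrow> conj_diag v u (conj_diag u v g) = g"
  by (simp add: conj_diag_conj_diag mult.commute) (simp add: conj_diag_def)

lemma det_conj_diag: "u * v = 1 \<Longrightarrow> det (conj_diag u v g) = det g"
  by (simp add: conj_diag_def det_mul) (metis mult.assoc mult.commute mult.right_neutral)

lemma conj_diag_mult:
  assumes "u * v = 1"
  shows "conj_diag u v (g ** h) = conj_diag u v g ** conj_diag u v h"
proof -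
  have "diag_matrix v ** diag_matrix u = mat 1"
    using assms by (simp add: diag_matrix_mult[symmetric] mult.commute)
  then have "x ** diag_matrix v ** diag_matrix u = x" for x :: "adele^2^2"
    by (simp add: matrix_mul_assoc[symmetric])
  then show ?thesis by (simp add: conj_diag_def matrix_mul_assoc)
qed

lemma conj_diag_in_G_tilde: "u * v = 1 \<Longrightarrow> g \<in> G_tilde \<Longrightarrow> conj_diag u v g \<in> G_tilde"
  by (simp add: G_tilde_iff det_conj_diag)

text \<open>Exchanging \<open>u\<close> with its inverse absorbs the opposite order of conjugation
  in the definition.\<close>

lemma Delta_class_iff:
  "h \<in> Delta_class g \<longleftrightarrow> (\<exists>u\<in>Zhat_units. \<exists>v\<in>Zhat_units. u * v = 1 \<and> h = conj_diag u v g)"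
proof
  assume "h \<in> Delta_class g"
  then obtain u where u: "u \<in> Zhat_units" "h = matrix_inv (diag_matrix u) ** g ** diag_matrix u"
    by (auto simp: Delta_class_def)
  then obtain v where "v \<in> Zhat_units" "u * v = 1" using Zhat_units_inverse by blast
  with u show "\<exists>u\<in>Zhat_units. \<exists>v\<in>Zhat_units. u * v = 1 \<and> h = conj_diag u v g"
    by (metis conj_diag_def matrix_inv_diag_matrix mult.commute)
next
  assume "\<exists>u\<in>Zhat_units. \<exists>v\<in>Zhat_units. u * v = 1 \<and> h = conj_diag u v g"
  then show "h \<in> Delta_class g"
    unfolding Delta_class_def by (smt (verit) conj_diag_def matrix_inv_diag_matrix mem_Collect_eq mult.commute)
qed

lemma conj_diag_Delta_class:
  assumes "u \<in> Zhat_units" "v \<in> Zhat_units" "u * v = 1"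
  shows "conj_diag u v ` Delta_class g = Delta_class g" (is "_ = ?A")
proof -
  \<comment> \<open>Stated for all units, the inclusion also covers the inverse conjugation, which
    yields the reverse inclusion.\<close>
  have sub: "conj_diag x y h \<in> Delta_class g"
    if "x \<in> Zhat_units" "y \<in> Zhat_units" "x * y = 1" and h: "h \<in> Delta_class g" for x y h
  proof -
    obtain x' y' where *: "x' \<in> Zhat_units" "y' \<in> Zhat_units" "x' * y' = 1" "h = conj_diag x' y' g"
      using h by (auto simp: Delta_class_iff)
    have "(x * x') * (y * y') = (x * y) * (x' * y')" by (simp add: ac_simps)
    then show ?thesis
      unfolding Delta_class_iff *(4) conj_diag_conj_diag using * that Zhat_units_mult
      by (metis mult.right_neutral)
  qed
  have vu: "v * u = 1" using assms(3) by (simp add: mult.commute)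
  show ?thesis
  proof (intro equalityI subsetI)
    show "h \<in> conj_diag u v ` ?A" if "h \<in> ?A" for h
      using sub[OF assms(2,1) vu that] conj_diag_inverse[OF vu, of h] by (metis imageI)
  qed (use sub[OF assms] in blast)
qed

text \<open>Conjugation fixes the diagonal entries and multiplies the others by profinite units, so
  integrality and the congruence modulo \<open>N\<close> survive.\<close>

lemma conj_diag_Gamma_tilde:
  assumes "u \<in> Zhat_units" "v \<in> Zhat_units" "u * v = 1"
  shows "conj_diag u v ` Gamma_tilde N = Gamma_tilde N" (is "_ = ?A")
proof -
  have sub: "conj_diag x y h \<in> Gamma_tilde N"
    if xy: "x \<in> Zhat_units" "y \<in> Zhat_units" "x * y = 1" and h: "h \<in> Gamma_tilde N" for x y h
  proof -
    have scale: "\<exists>z\<in>Zhat. c * e = of_nat N * z" if "c \<in> Zhat_units" "\<exists>z\<in>Zhat. e = of_nat N * z" for c e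
      using that by (metis Zhat_mult Zhat_unitsD mult.left_commute)
    show ?thesis
      using h xy(1,2) unfolding Gamma_tilde_def
      by (simp add: forall_2 conj_diag_nth[OF xy(3)] det_conj_diag[OF xy(3)] Zhat_mult Zhat_unitsD scale)
  qed
  have vu: "v * u = 1" using assms(3) by (simp add: mult.commute)
  show ?thesis
  proof (intro equalityI subsetI)
    show "h \<in> conj_diag u v ` ?A" if "h \<in> ?A" for h
      using sub[OF assms(2,1) vu that] conj_diag_inverse[OF vu, of h] by (metis imageI)
  qed (use sub[OF assms] in blast)
qed

text \<open>Elements of \<open>auto\<close> are extensional, whence the restriction.\<close>

lemma conj_diag_auto:
  assumes uv: "u * v = 1"
  shows "restrict (conj_diag u v) G_tilde \<in> auto G_tilde_group"
proof -
  have vu: "v * u = 1" using uv by (simp add: mult.commute)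
  have "g ** h \<in> G_tilde" if "g \<in> G_tilde" "h \<in> G_tilde" for g h
    using that by (simp add: G_tilde_iff det_mul Q_pos_mult)
  then have "restrict (conj_diag u v) G_tilde \<in> hom G_tilde_group G_tilde_group"
    by (auto simp: hom_def G_tilde_group_def conj_diag_in_G_tilde[OF uv] conj_diag_mult[OF uv])
  moreover have "bij_betw (conj_diag u v) G_tilde G_tilde"
    by (rule bij_betw_byWitness[where f' = "conj_diag v u"])
      (auto simp: conj_diag_inverse uv vu conj_diag_in_G_tilde)
  then have "restrict (conj_diag u v) G_tilde \<in> Bij (carrier G_tilde_group)"
    by (simp add: Bij_def G_tilde_group_def)
  ultimately show ?thesis by (simp add: auto_def)
qed


text \<open>An automorphism preserving the classes \<open>Delta_class g\<close> multiplies the off-diagonal entries of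
  each \<open>g\<close> by units depending on \<open>g\<close>; multiplying \<open>g\<close> by the two elementary unipotent matrices
  shows that these units can be chosen independently of \<open>g\<close>.\<close>

lemma G_tilde_auto_is_conj_diag:
  assumes \<phi>: "\<phi> \<in> auto G_tilde_group" and Delta: "\<And>g. g \<in> G_tilde \<Longrightarrow> \<phi> ` Delta_class g = Delta_class g"
  obtains k k' where "k \<in> Zhat_units" "k' \<in> Zhat_units" "k * k' = 1"
    "\<And>g. g \<in> G_tilde \<Longrightarrow> \<phi> g = conj_diag k k' g"
proof -
  define U L :: "adele^2^2" where
    "U = vector [vector [1, 1], vector [0, 1]]" and "L = vector [vector [1, 0], vector [1, 1]]"
  have UL [simp]: "U$1$1 = 1" "U$1$2 = 1" "U$2$1 = 0" "U$2$2 = 1"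
    "L$1$1 = 1" "L$1$2 = 0" "L$2$1 = 1" "L$2$2 = 1"
    by (simp_all add: U_def L_def)
  have G: "U \<in> G_tilde" "L \<in> G_tilde" by (simp_all add: G_tilde_iff det_2 Q_pos_1)
  have closed: "g ** h \<in> G_tilde" if "g \<in> G_tilde" "h \<in> G_tilde" for g h
    using that by (simp add: G_tilde_iff det_mul Q_pos_mult)
  have hom: "\<phi> (g ** h) = \<phi> g ** \<phi> h" if "g \<in> G_tilde" "h \<in> G_tilde" for g h
    using that \<phi> by (auto simp: auto_def hom_def G_tilde_group_def)
  have "g \<in> Delta_class g" for g
    unfolding Delta_class_iff using Zhat_units_1 by (force simp: conj_diag_def)
  then have "\<phi> g \<in> Delta_class g" if "g \<in> G_tilde" for g
    using Delta[OF that] by blast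
  then have conj: "\<exists>x\<in>Zhat_units. \<exists>y\<in>Zhat_units. x * y = 1 \<and> \<phi> g = conj_diag x y g" if "g \<in> G_tilde" for g
    using that unfolding Delta_class_iff by blast
  obtain k k' where k: "k \<in> Zhat_units" "k' \<in> Zhat_units" "k * k' = 1" "\<phi> U = conj_diag k k' U"
    using conj[OF G(1)] by blast
  obtain c c' where c: "c * c' = 1" "\<phi> L = conj_diag c c' L"
    using conj[OF G(2)] by blast
  obtain e e' where e: "e * e' = 1" "\<phi> (U ** L) = conj_diag e e' (U ** L)"
    using conj[OF closed[OF G]] by blast
  \<comment> \<open>Conjugation fixes diagonal entries: the entry 2 of \<open>U ** L\<close> must
    equal \<open>1 + k * c'\<close>, so \<open>U\<close> and \<open>L\<close> are conjugated by the
    same unit.\<close>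
  have "(U ** L) $ 1 $ 1 = (conj_diag k k' U ** conj_diag c c' L) $ 1 $ 1"
    using hom[OF G] e c k by (metis conj_diag_nth(1))
  then have "k * c' = 1"
    using k c by (simp add: matrix_mult_2 conj_diag_nth)
  then have "c' = k'" using k(3) unit_mult_shift[of k' k 1 c'] by (simp add: mult.commute)
  have "\<phi> g = conj_diag k k' g" if g: "g \<in> G_tilde" for g
  proof -
    obtain x y where xy: "x * y = 1" "\<phi> g = conj_diag x y g" using conj[OF g] by blast
    obtain p p' where p: "p * p' = 1" "\<phi> (g ** U) = conj_diag p p' (g ** U)"
      using conj[OF closed[OF g G(1)]] by blast
    obtain q q' where q: "q * q' = 1" "\<phi> (g ** L) = conj_diag q q' (g ** L)"
      using conj[OF closed[OF g G(2)]] by blast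
    \<comment> \<open>Multiplying by \<open>U\<close> adds \<open>g$2$1\<close> to a diagonal entry,
      and multiplying by \<open>L\<close> does so with \<open>g$1$2\<close>. Only the products with
      \<open>x\<close> and \<open>y\<close> get determined, since the entries of \<open>g\<close>
      may be zero divisors.\<close>
    have "(g ** U) $ 2 $ 2 = (conj_diag x y g ** conj_diag k k' U) $ 2 $ 2"
      using hom[OF g G(1)] p k xy by (metis conj_diag_nth(4))
    then have "g$2$1 = y * g$2$1 * k"
      using k xy by (simp add: matrix_mult_2 conj_diag_nth)
    then have "y * g$2$1 = k' * g$2$1"
      using k(3) by (intro unit_mult_shift[of k' k]) (simp_all add: mult.commute)
    moreover have "(g ** L) $ 1 $ 1 = (conj_diag x y g ** conj_diag c c' L) $ 1 $ 1"
      using hom[OF g G(2)] q c xy by (metis conj_diag_nth(1))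
    then have "g$1$2 = x * g$1$2 * k'"
      using c xy by (simp add: matrix_mult_2 conj_diag_nth \<open>c' = k'\<close>)
    then have "x * g$1$2 = k * g$1$2" by (rule unit_mult_shift[OF k(3)])
    ultimately show ?thesis using xy k by (simp add: matrix_eq_2 conj_diag_nth)
  qed
  with k show ?thesis using that by blast
qed


subsection \<open>Automorphisms of the pure structure\<close>

text \<open>A rational \<open>q\<close> witnessing that \<open>g\<close> fixes the point can only be
  the conjugate of \<open>g\<close> by \<open>a\<close>. The lemma recovers the stabiliser of \<tau>
  from the action alone, which every automorphism respects.\<close>

lemma act_pt_fixed_iff:
  assumes "Im \<tau> \<noteq> 0" "invertible a" "invertible g"
  shows "act g (pt \<tau> a) = pt \<tau> a \<longleftrightarrow> a ** g ** matrix_inv a \<in> adele_matrix ` stabiliser \<tau>"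
proof -
  have "act g (pt \<tau> a) = pt \<tau> a \<longleftrightarrow> (\<exists>q\<in>stabiliser \<tau>. a = adele_matrix q ** (a ** matrix_inv g))"
    using assms by (auto simp: act_pt pt_eq_iff invertible_mult invertible_matrix_inv stabiliser_def)
  also have "\<dots> \<longleftrightarrow> (\<exists>q\<in>stabiliser \<tau>. a ** g ** matrix_inv a = adele_matrix q)"
  proof (intro bex_cong refl iffI)
    fix q assume eq: "a = adele_matrix q ** (a ** matrix_inv g)"
    have "a ** g ** matrix_inv a = adele_matrix q ** (a ** matrix_inv g) ** g ** matrix_inv a"
      using eq by simp
    then show "a ** g ** matrix_inv a = adele_matrix q"
      using assms by (simp add: matrix_mul_assoc matrix_mul_cancel)
  next
    fix q assume "a ** g ** matrix_inv a = adele_matrix q"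
    then have "adele_matrix q ** (a ** matrix_inv g) = a ** g ** matrix_inv a ** (a ** matrix_inv g)"
      by simp
    then show "a = adele_matrix q ** (a ** matrix_inv g)"
      using assms by (simp add: matrix_mul_assoc matrix_mul_cancel)
  qed
  finally show ?thesis by auto
qed

text \<open>The trace and determinant of a rational matrix are conjugation invariants, and an element of
  trace zero and determinant \<open>m\<close> determines its fixed points up to a rational fractional linear
  transformation of \<open>\<i> \<surd>m\<close>.\<close>

lemma fixed_point_trace_0:
  fixes p :: "rat^2^2"
  assumes \<tau>: "Im \<tau> \<noteq> 0" and p: "p \<in> stabiliser \<tau>" "p$1$1 + p$2$2 = 0" "det p = of_nat m" and m: "0 < m"
  obtains q where "invertible q" "\<tau> = moebius_act q (\<i> * of_real (sqrt (real m)))"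
proof -
  define x y z where "x = p$1$1" and "y = p$1$2" and "z = p$2$1"
  have p22: "p$2$2 = - x" using p(2) by (simp add: x_def add_eq_0_iff)
  have det: "- x * x - y * z = of_nat m" using p(3) by (simp add: det_2 p22 flip: x_def y_def z_def)
  have "z \<noteq> 0"
  proof
    assume "z = 0"
    then have "- x * x = of_nat m" using det by simp
    moreover have "0 \<le> x * x" by simp
    moreover have "(0::rat) < of_nat m" using m by simp
    ultimately show False by linarith
  qed
  \<comment> \<open>\<open>c\<close> is the eigenvalue of \<open>p\<close> on the vector with
    entries \<tau> and 1; by trace zero and determinant \<open>m\<close> its square is
    \<open>- m\<close>.\<close>
  define c where "c = of_rat z * \<tau> - of_rat x"
  have "invertible p" "moebius_act p \<tau> = \<tau>" using p(1) by (auto simp: stabiliser_def)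
  then have "of_rat x * \<tau> + of_rat y = \<tau> * c"
    using moebius_denominator[OF _ \<tau>, of p]
    by (simp add: moebius_act_def p22 c_def of_rat_minus divide_simps flip: x_def y_def z_def)
  moreover have "c\<^sup>2 = of_rat z * (\<tau> * c) - of_rat x * c"
    by (simp add: c_def power2_eq_square algebra_simps)
  ultimately have "c\<^sup>2 = of_rat z * (of_rat x * \<tau> + of_rat y) - of_rat x * c"
    by simp
  then have "c\<^sup>2 = of_rat (x * x + y * z)"
    by (simp add: c_def of_rat_add of_rat_mult algebra_simps)
  also have "x * x + y * z = - of_nat m" using det by simp
  finally have "c\<^sup>2 = (\<i> * of_real (sqrt (real m)))\<^sup>2"
    by (simp add: power_mult_distrib of_rat_minus flip: of_real_power)
  then have "c = \<i> * of_real (sqrt (real m)) \<or> c = - (\<i> * of_real (sqrt (real m)))"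
    by (simp only: power2_eq_iff)
  then obtain e :: rat where e: "e = 1 \<or> e = - 1" "c = of_rat e * (\<i> * of_real (sqrt (real m)))"
    by (metis mult_1 mult_minus1 of_rat_1 of_rat_neg_one)
  \<comment> \<open>Solving the definition of \<open>c\<close> for \<tau> gives
    \<open>(c + x) / z\<close>, and \<open>c\<close> is the chosen root up to the sign
    \<open>e\<close>; \<open>q\<close> is the matrix of this expression.\<close>
  define q :: "rat^2^2" where "q = vector [vector [e, x], vector [0, z]]"
  have "invertible q" using e \<open>z \<noteq> 0\<close> by (auto simp: q_def invertible_det_nz det_2)
  moreover have "\<tau> = moebius_act q (\<i> * of_real (sqrt (real m)))"
    using \<open>z \<noteq> 0\<close> by (simp add: q_def moebius_act_def flip: e(2)) (simp add: c_def)
  ultimately show ?thesis by (rule that)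
qed

section \<open>Normalisers of the stabilisers\<close>

text \<open>Normalising demands equality of two sets. The backward direction of \<open>iff\<close>,
  applied to the conjugate of \<open>h\<close> by the inverse of \<open>w\<close>, shows that every
  \<open>h\<close> in the group is hit.\<close>

lemma normaliserI:
  assumes w: "invertible w"
    and iff: "\<And>g. invertible g \<Longrightarrow>
      g \<in> adele_matrix ` stabiliser \<tau> \<longleftrightarrow> w ** g ** matrix_inv w \<in> adele_matrix ` stabiliser \<tau>"
  shows "w \<in> normaliser \<tau>"
proof -
  let ?M = "adele_matrix ` stabiliser \<tau>"
  have inv: "invertible g" if "g \<in> ?M" for g
    using that by (auto simp: stabiliser_def invertible_adele_matrix)
  have "(\<lambda>x. w ** x ** matrix_inv w) ` ?M = ?M"
  proof (intro equalityI subsetI)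
    show "h \<in> ?M" if "h \<in> (\<lambda>x. w ** x ** matrix_inv w) ` ?M" for h
      using that iff inv by fastforce
  next
    fix h assume h: "h \<in> ?M"
    define g where "g = matrix_inv w ** h ** w"
    have "invertible g"
      using inv[OF h] w by (simp add: g_def invertible_mult invertible_matrix_inv)
    moreover have eq: "w ** g ** matrix_inv w = h"
      using w by (simp add: g_def matrix_mul_assoc matrix_mul_cancel matrix_inv_both)
    ultimately have "g \<in> ?M" using iff h by simp
    then show "h \<in> (\<lambda>x. w ** x ** matrix_inv w) ` ?M" using eq by blast
  qed
  then show ?thesis using w by (simp add: normaliser_def)
qed

lemma normaliser_conj_iff:
  assumes "w \<in> normaliser \<tau>"
  shows "w ** g ** matrix_inv w \<in> adele_matrix ` stabiliser \<tau> \<longleftrightarrow> g \<in> adele_matrix ` stabiliser \<tau>"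
    (is "_ \<in> ?M \<longleftrightarrow> _")
proof -
  have w: "invertible w" and eq: "(\<lambda>x. w ** x ** matrix_inv w) ` ?M = ?M"
    using assms by (auto simp: normaliser_def)
  have "inj (\<lambda>x. w ** x ** matrix_inv w)"
    by (rule inj_on_inverseI[where g = "\<lambda>x. matrix_inv w ** x ** w"])
      (use w in \<open>simp add: matrix_mul_assoc matrix_mul_cancel matrix_inv_both\<close>)
  then show ?thesis using eq by (metis inj_image_mem_iff)
qed

text \<open>Conjugation by the product is a composition of three conjugations, each preserving
  membership in both directions. These conjugates replace the matrices \<open>r1\<close>,
  \<open>r2\<close> of \<open>R_at\<close> under an automorphism.\<close>

lemma normaliser_conj:
  assumes w: "w \<in> normaliser \<tau>" and r: "r \<in> normaliser \<tau>"
  shows "w ** r ** matrix_inv w \<in> normaliser \<tau>"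
proof (rule normaliserI)
  have inv: "invertible w" "invertible r" using w r by (auto simp: normaliser_def)
  then show "invertible (w ** r ** matrix_inv w)"
    by (simp add: invertible_mult invertible_matrix_inv)
  fix g
  let ?g = "matrix_inv w ** g ** w"
  have "w ** r ** matrix_inv w ** g ** matrix_inv (w ** r ** matrix_inv w) = w ** (r ** ?g ** matrix_inv r) ** matrix_inv w"
    using inv by (simp add: matrix_inv_mult invertible_mult invertible_matrix_inv matrix_inv_involutive matrix_mul_assoc)
  moreover have "w ** ?g ** matrix_inv w = g"
    using inv by (simp add: matrix_mul_assoc matrix_mul_cancel matrix_inv_both)
  ultimately show "g \<in> adele_matrix ` stabiliser \<tau> \<longleftrightarrow>
      w ** r ** matrix_inv w ** g ** matrix_inv (w ** r ** matrix_inv w) \<in> adele_matrix ` stabiliser \<tau>"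
    using normaliser_conj_iff[OF w] normaliser_conj_iff[OF r] by metis
qed

section \<open>One automorphism: its effect on components and special points\<close>

text \<open>Treats all points and the CM-points at once. The point [\<i>, 1] serves as the origin
  from which the shift of components is read off.\<close>

locale invariant_points =
  fixes X :: "shimura set"
  assumes act_closed: "invertible g \<Longrightarrow> s \<in> X \<Longrightarrow> act g s \<in> X"
    and base: "pt \<i> (mat 1) \<in> X"
begin

lemma act_diag_closed: "u \<in> Zhat_units \<Longrightarrow> s \<in> X \<Longrightarrow> act (diag_matrix u) s \<in> X"
  by (simp add: act_closed invertible_diag_matrix)

lemma approx_mem_iff: "approx s \<in> approx ` X \<longleftrightarrow> s \<in> X"
proof
  assume "approx s \<in> approx ` X"
  then obtain t where "t \<in> X" "approx t = approx s" by force
  then show "s \<in> X" by (auto simp: approx_eq_iff Delta_rel_def act_diag_closed)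
qed simp

lemma base_component: "pt \<i> (mat 1) \<in> component 1"
  by (subst pt_mem_component_iff) (auto simp: Q_pos_1 invertible_def)

context
  fixes F assumes F: "F \<in> Aut_Pure X"
begin

lemma F_mem: "s \<in> X \<Longrightarrow> F s \<in> X"
  using F by (auto simp: Aut_Pure_def dest: Bij_imp_funcset)

lemma F_inj: "s \<in> X \<Longrightarrow> t \<in> X \<Longrightarrow> F s = F t \<longleftrightarrow> s = t"
  using F by (auto simp: Aut_Pure_def Bij_def bij_betw_def inj_on_eq_iff)

lemma F_act: "invertible g \<Longrightarrow> s \<in> X \<Longrightarrow> F (act g s) = act g (F s)"
  using F by (auto simp: Aut_Pure_def)

lemma F_act_diag: "u \<in> Zhat_units \<Longrightarrow> s \<in> X \<Longrightarrow> F (act (diag_matrix u) s) = act (diag_matrix u) (F s)"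
  by (simp add: F_act invertible_diag_matrix)

lemma F_same_component: "s \<in> X \<Longrightarrow> t \<in> X \<Longrightarrow> same_component (F s) (F t) \<longleftrightarrow> same_component s t"
  using F by (auto simp: Aut_Pure_def)

text \<open>\<open>k\<close> is the component of the image of the base point. Moving
  \<open>s\<close> by \<open>diag_matrix u\<close> into \<open>component 1\<close> puts its image
  into \<open>component k\<close>, and moving back multiplies the index by \<open>u\<close>.\<close>

lemma component_shift:
  obtains k where "k \<in> Zhat_units"
    "\<And>s u. s \<in> X \<Longrightarrow> u \<in> Zhat_units \<Longrightarrow> s \<in> component u \<Longrightarrow> F s \<in> component (k * u)"
proof -
  obtain k where k: "k \<in> Zhat_units" "F (pt \<i> (mat 1)) \<in> component k" by (rule component_cover)
  have "F s \<in> component (k * u)" if s: "s \<in> X" "s \<in> component u" and u: "u \<in> Zhat_units" for s u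
  proof -
    obtain v where v: "v \<in> Zhat_units" "u * v = 1" using Zhat_units_inverse[OF u] .
    have vu: "v * u = 1" using v by (simp add: mult.commute)
    have "same_component (pt \<i> (mat 1)) (act (diag_matrix u) s)"
      using base_component act_diag_mem_component[OF s(2) u v(2)] Zhat_units_1 v
      by (auto simp: same_component_def)
    then have "same_component (F (pt \<i> (mat 1))) (act (diag_matrix u) (F s))"
      using s u base by (simp add: F_same_component act_diag_closed flip: F_act_diag)
    then have "act (diag_matrix u) (F s) \<in> component k" using k(2,1) by (rule same_componentD)
    then have "act (diag_matrix v) (act (diag_matrix u) (F s)) \<in> component (k * u)"
      using v vu by (intro act_diag_mem_component)
    then show ?thesis using u v vu by (simp add: act_diag_inverse)
  qed
  with k that show ?thesis by blast
qed

text \<open>By injectivity and equivariance, [\<tau>, 1] and its image are fixed by the same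
  \<open>g\<close>. Comparing one such matrix through its trace and determinant puts the image over
  the rational orbit of \<tau>; once the image is written over \<tau> itself, equality of the fixing
  groups is the normaliser condition.\<close>

lemma F_special:
  assumes m: "0 < m" and \<tau>: "\<tau> = \<i> * of_real (sqrt (real m))" and X: "pt \<tau> (mat 1) \<in> X"
  obtains w where "w \<in> normaliser \<tau>" "\<And>a. invertible a \<Longrightarrow> F (pt \<tau> a) = pt \<tau> (w ** a)"
proof -
  let ?s = "pt \<tau> (mat 1)"
  have Im: "Im \<tau> \<noteq> 0" using m by (simp add: \<tau>)
  have inv1: "invertible (mat 1 :: adele^2^2)" "matrix_inv (mat 1 :: adele^2^2) = mat 1"
    by (auto simp: invertible_def intro: matrix_inv_unique_ring)
  have fixed: "g \<in> adele_matrix ` stabiliser \<tau> \<longleftrightarrow> act g (F ?s) = F ?s" if "invertible g" for g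
    using act_pt_fixed_iff[OF Im inv1(1) that] F_inj[of "act g ?s" ?s] F_act[of g ?s] that X
    by (simp add: inv1 act_closed)
  obtain \<tau>' w' where w': "F ?s = pt \<tau>' w'" "Im \<tau>' \<noteq> 0" "invertible w'"
    by (cases "F ?s")
  \<comment> \<open>This matrix of trace zero and determinant \<open>m\<close> acts by
    \<open>- m / \<tau>\<close>, hence fixes \<tau>.\<close>
  define q0 :: "rat^2^2" where "q0 = vector [vector [0, - of_nat m], vector [1, 0]]"
  have q0: "invertible q0" using m by (simp add: q0_def invertible_det_nz det_2)
  have "\<tau>\<^sup>2 = - of_nat m"
    by (simp add: \<tau> power_mult_distrib flip: of_real_power)
  then have "\<tau> * \<tau> = - of_nat m" by (simp only: power2_eq_square)
  then have "q0 \<in> stabiliser \<tau>"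
    using q0 Im by (auto simp: stabiliser_def q0_def moebius_act_def of_rat_minus divide_simps)
  then have "act (adele_matrix q0) (F ?s) = F ?s"
    using fixed[OF invertible_adele_matrix[OF q0]] by blast
  then obtain p where p: "w' ** adele_matrix q0 ** matrix_inv w' = adele_matrix p" "p \<in> stabiliser \<tau>'"
    using act_pt_fixed_iff w' q0 by (auto simp: invertible_adele_matrix)
  have pq: "adele_matrix p = w' ** (adele_matrix q0 ** matrix_inv w')"
    using p by (simp add: matrix_mul_assoc)
  have "trace (adele_matrix p) = trace (adele_matrix q0)"
    unfolding pq using w' by (subst trace_mul_sym) (simp add: matrix_mul_assoc matrix_mul_cancel matrix_inv_both)
  then have "adele_of_rat (p$1$1 + p$2$2) = adele_of_rat 0"
    by (simp add: trace_def sum_2 adele_matrix_def adele_of_rat_add q0_def)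
  then have "p$1$1 + p$2$2 = 0" by (simp only: adele_of_rat_inject)
  moreover have "det w' * det (matrix_inv w') = 1"
    using w' by (metis det_I det_mul matrix_inv_both(1))
  then have "det (adele_matrix p) = det (adele_matrix q0)"
    unfolding pq by (simp add: det_mul) (metis mult.left_commute mult.right_neutral)
  then have "det p = det q0" by (simp only: det_adele_matrix adele_of_rat_inject)
  then have "det p = of_nat m" by (simp add: q0_def det_2)
  ultimately obtain q where q: "invertible q" "\<tau>' = moebius_act q \<tau>"
    using fixed_point_trace_0[OF w'(2) p(2)] m unfolding \<tau> by blast
  define w where "w = adele_matrix (matrix_inv q) ** w'"
  have w: "invertible w"
    using w' q by (simp add: w_def invertible_mult invertible_adele_matrix invertible_matrix_inv)
  have "adele_matrix q ** w = w'"
    using q by (simp add: w_def matrix_mul_assoc matrix_inv_both flip: adele_matrix_mult)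
  then have Fs: "F ?s = pt \<tau> w"
    unfolding w'(1) using w w' q Im by (subst eq_commute, subst pt_eq_iff) auto
  have "w \<in> normaliser \<tau>"
    using w fixed act_pt_fixed_iff[OF Im w] by (intro normaliserI) (auto simp: Fs)
  moreover have "F (pt \<tau> a) = pt \<tau> (w ** a)" if a: "invertible a" for a
  proof -
    \<comment> \<open>All points over \<tau> are translates of [\<tau>, 1], so equivariance
      determines \<open>F\<close> on them.\<close>
    have "pt \<tau> a = act (matrix_inv a) ?s"
      using Im a inv1 by (simp add: act_pt invertible_matrix_inv matrix_inv_involutive)
    then have "F (pt \<tau> a) = act (matrix_inv a) (pt \<tau> w)"
      using a X by (simp add: F_act invertible_matrix_inv Fs)
    then show ?thesis using Im a w by (simp add: act_pt invertible_matrix_inv matrix_inv_involutive)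
  qed
  ultimately show ?thesis by (rule that)
qed

end

section \<open>Descent of automorphisms to the quotient\<close>

text \<open>Serves to obtain the converse implication for \<open>R_rel\<close> from
  \<open>R_rel_induced\<close>.\<close>

lemma Aut_Pure_inverse:
  assumes F: "F \<in> Aut_Pure X"
  shows "restrict (inv_into X F) X \<in> Aut_Pure X"
proof -
  have bij: "bij_betw F X X" using F by (simp add: Aut_Pure_def Bij_def)
  let ?G = "inv_into X F"
  have G: "?G s \<in> X" "F (?G s) = s" if "s \<in> X" for s
    using bij that by (auto simp: bij_betw_def inv_into_into f_inv_into_f)
  have "?G (act g s) = act g (?G s)" if "invertible g" "s \<in> X" for g s
    using that G[of s] G[of "act g s"] F_inj[OF F] F_act[OF F] act_closed by metis
  moreover have "same_component s t \<longleftrightarrow> same_component (?G s) (?G t)" if "s \<in> X" "t \<in> X" for s t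
    using that G F_same_component[OF F] by metis
  moreover have "restrict ?G X \<in> Bij X"
    using F by (simp add: Aut_Pure_def restrict_inv_into_Bij)
  ultimately show ?thesis by (simp add: Aut_Pure_def act_closed)
qed

text \<open>On canonical representatives over \<tau> the induced map sends \<open>a\<close> to
  \<open>w ** a ** diag_matrix k'\<close>, with \<open>w\<close> in the normaliser and
  \<open>k'\<close> restoring a rational determinant. The relation persists with each
  \<open>r\<close> replaced by its conjugate under \<open>w\<close>.\<close>

lemma R_rel_induced:
  assumes F: "F \<in> Aut_Pure X" and ind: "induces X F f"
    and mem: "s1 \<in> approx ` X" "s2 \<in> approx ` X" "t1 \<in> approx ` X" "t2 \<in> approx ` X"
    and R: "R_rel s1 s2 t1 t2"
  shows "R_rel (f s1) (f s2) (f t1) (f t2)"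
proof -
  obtain k where k: "k \<in> Zhat_units"
    "\<And>s u. s \<in> X \<Longrightarrow> u \<in> Zhat_units \<Longrightarrow> s \<in> component u \<Longrightarrow> F s \<in> component (k * u)"
    using component_shift[OF F] by blast
  obtain k' where k': "k' \<in> Zhat_units" "k * k' = 1" using Zhat_units_inverse[OF k(1)] .
  have image: "\<exists>w\<in>normaliser \<tau>. \<forall>a. canonical \<tau> a \<longrightarrow> pt_approx \<tau> a \<in> approx ` X \<longrightarrow>
      canonical \<tau> (w ** a ** diag_matrix k') \<and> f (pt_approx \<tau> a) = pt_approx \<tau> (w ** a ** diag_matrix k')"
    if m: "0 < m" and \<tau>: "\<tau> = \<i> * of_real (sqrt (real m))"
      and a0: "canonical \<tau> a0" "pt_approx \<tau> a0 \<in> approx ` X" for m \<tau> a0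
  proof -
    have Im: "0 < Im \<tau>" using m by (simp add: \<tau>)
    \<comment> \<open>One point of \<open>X\<close> over \<tau> brings [\<tau>, 1] into
      \<open>X\<close>, as \<open>F_special\<close> requires.\<close>
    have "act a0 (pt \<tau> a0) = pt \<tau> (mat 1)"
      using a0 Im by (simp add: act_pt canonical_def matrix_inv_both)
    then have "pt \<tau> (mat 1) \<in> X"
      using a0 act_closed by (metis approx_mem_iff canonical_def pt_approx_def)
    then obtain w where w: "w \<in> normaliser \<tau>" "\<And>a. invertible a \<Longrightarrow> F (pt \<tau> a) = pt \<tau> (w ** a)"
      using F_special[OF F m \<tau>] by blast
    have inv_w: "invertible w" using w(1) by (simp add: normaliser_def)
    have "canonical \<tau> (w ** a ** diag_matrix k') \<and> f (pt_approx \<tau> a) = pt_approx \<tau> (w ** a ** diag_matrix k')"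
      if a: "canonical \<tau> a" "pt_approx \<tau> a \<in> approx ` X" for a
    proof -
      have inv_a: "invertible a" and aX: "pt \<tau> a \<in> X"
        using a by (simp_all add: canonical_def pt_approx_def approx_mem_iff)
      have inv: "invertible (w ** a ** diag_matrix k')"
        using inv_w inv_a k' by (simp add: invertible_mult invertible_diag_matrix)
      have "pt \<tau> a \<in> component 1" using a(1) Im inv_a by (simp add: pt_mem_component_1_iff)
      \<comment> \<open>\<open>F\<close> lands in \<open>component k\<close>;
        \<open>diag_matrix k\<close> returns the image to \<open>component 1\<close> without
        changing its class.\<close>
      then have "act (diag_matrix k) (F (pt \<tau> a)) \<in> component (k * 1 * k')"
        using k' aX by (intro act_diag_mem_component k Zhat_units_1)
      moreover have eq: "act (diag_matrix k) (F (pt \<tau> a)) = pt \<tau> (w ** a ** diag_matrix k')"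
        using Im inv_w inv_a k k'
        by (simp add: w(2) act_pt invertible_mult invertible_diag_matrix matrix_inv_diag_matrix)
      ultimately have "canonical \<tau> (w ** a ** diag_matrix k')"
        using k' Im inv by (simp add: pt_mem_component_1_iff)
      moreover have "f (pt_approx \<tau> a) = approx (F (pt \<tau> a))"
        using ind aX by (simp add: induces_def pt_approx_def)
      ultimately show ?thesis using approx_act_diag[OF k(1)] eq by (metis pt_approx_def)
    qed
    with w(1) show ?thesis by blast
  qed
  obtain m1 m2 :: nat where m: "0 < m1" "0 < m2" "squarefree m1" "squarefree m2"
    and at: "R_at (\<i> * of_real (sqrt (real m1))) (\<i> * of_real (sqrt (real m2))) s1 s2 t1 t2"
    using R by (auto simp: R_rel_def)
  define \<tau>1 \<tau>2 where \<tau>: "\<tau>1 = \<i> * of_real (sqrt (real m1))" "\<tau>2 = \<i> * of_real (sqrt (real m2))"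
  obtain a1 a2 b1 b2 r1 r2 where
    can: "canonical \<tau>1 a1" "canonical \<tau>2 a2" "canonical \<tau>1 b1" "canonical \<tau>2 b2"
    and pts: "s1 = pt_approx \<tau>1 a1" "s2 = pt_approx \<tau>2 a2" "t1 = pt_approx \<tau>1 b1" "t2 = pt_approx \<tau>2 b2"
    and r: "r1 \<in> normaliser \<tau>1" "r2 \<in> normaliser \<tau>2" "det r1 = det r2" "det r1 \<in> Zhat_units"
    and b: "b1 = r1 ** a1 ** matrix_inv (diag_matrix (det r1))"
      "b2 = r2 ** a2 ** matrix_inv (diag_matrix (det r2))"
    using at unfolding R_at_def \<tau>[symmetric] by blast
  obtain w1 where w1: "w1 \<in> normaliser \<tau>1"
    "\<And>a. canonical \<tau>1 a \<Longrightarrow> pt_approx \<tau>1 a \<in> approx ` X \<Longrightarrow>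
      canonical \<tau>1 (w1 ** a ** diag_matrix k') \<and> f (pt_approx \<tau>1 a) = pt_approx \<tau>1 (w1 ** a ** diag_matrix k')"
    using image[OF m(1) \<tau>(1) can(1)] mem(1) unfolding pts(1) by blast
  obtain w2 where w2: "w2 \<in> normaliser \<tau>2"
    "\<And>a. canonical \<tau>2 a \<Longrightarrow> pt_approx \<tau>2 a \<in> approx ` X \<Longrightarrow>
      canonical \<tau>2 (w2 ** a ** diag_matrix k') \<and> f (pt_approx \<tau>2 a) = pt_approx \<tau>2 (w2 ** a ** diag_matrix k')"
    using image[OF m(2) \<tau>(2) can(2)] mem(2) unfolding pts(2) by blast
  have det_conj: "det (w ** r ** matrix_inv w) = det r" if "w \<in> normaliser \<tau>" for w r \<tau>
  proof -
    have "det w * det (matrix_inv w) = 1"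
      using that by (metis (lifting) det_I det_mul matrix_inv_both(1) mem_Collect_eq normaliser_def)
    then show ?thesis by (simp add: det_mul) (metis mult.commute mult.left_commute mult.right_neutral)
  qed
  \<comment> \<open>Diagonal matrices commute and conjugation preserves \<open>det r\<close>, so it
    suffices to insert \<open>w\<close> and its inverse after \<open>r\<close>.\<close>
  have shift: "w ** (r ** a ** matrix_inv (diag_matrix (det r))) ** diag_matrix k'
      = (w ** r ** matrix_inv w) ** (w ** a ** diag_matrix k')
        ** matrix_inv (diag_matrix (det (w ** r ** matrix_inv w)))"
    if w: "w \<in> normaliser \<tau>" and r: "det r \<in> Zhat_units" for w r \<tau> a
  proof -
    obtain e where e: "det r * e = 1" using Zhat_units_inverse[OF r] by blast
    have inv: "invertible w" using w by (simp add: normaliser_def)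
    have "x ** diag_matrix e ** diag_matrix k' = x ** diag_matrix k' ** diag_matrix e" for x :: "adele^2^2"
      by (metis diag_matrix_commute matrix_mul_assoc)
    then show ?thesis
      using inv unfolding det_conj[OF w] matrix_inv_diag_matrix[OF e]
      by (simp add: matrix_mul_assoc matrix_mul_cancel)
  qed
  have "R_at \<tau>1 \<tau>2 (f s1) (f s2) (f t1) (f t2)"
    unfolding R_at_def
  proof (intro exI conjI)
    show "canonical \<tau>1 (w1 ** a1 ** diag_matrix k')" "canonical \<tau>1 (w1 ** b1 ** diag_matrix k')"
      "f s1 = pt_approx \<tau>1 (w1 ** a1 ** diag_matrix k')" "f t1 = pt_approx \<tau>1 (w1 ** b1 ** diag_matrix k')"
      using w1(2) can mem unfolding pts by blast+
    show "canonical \<tau>2 (w2 ** a2 ** diag_matrix k')" "canonical \<tau>2 (w2 ** b2 ** diag_matrix k')"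
      "f s2 = pt_approx \<tau>2 (w2 ** a2 ** diag_matrix k')" "f t2 = pt_approx \<tau>2 (w2 ** b2 ** diag_matrix k')"
      using w2(2) can mem unfolding pts by blast+
    show "w1 ** r1 ** matrix_inv w1 \<in> normaliser \<tau>1" "w2 ** r2 ** matrix_inv w2 \<in> normaliser \<tau>2"
      using normaliser_conj w1 w2 r by blast+
    show "det (w1 ** r1 ** matrix_inv w1) = det (w2 ** r2 ** matrix_inv w2)"
      "det (w1 ** r1 ** matrix_inv w1) \<in> Zhat_units"
      using r det_conj w1(1) w2(1) by metis+
    show "w1 ** b1 ** diag_matrix k' = (w1 ** r1 ** matrix_inv w1) ** (w1 ** a1 ** diag_matrix k')
        ** matrix_inv (diag_matrix (det (w1 ** r1 ** matrix_inv w1)))"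
      using shift[OF w1(1)] r b by metis
    show "w2 ** b2 ** diag_matrix k' = (w2 ** r2 ** matrix_inv w2) ** (w2 ** a2 ** diag_matrix k')
        ** matrix_inv (diag_matrix (det (w2 ** r2 ** matrix_inv w2)))"
      using shift[OF w2(1)] r b by metis
  qed
  then show ?thesis using m unfolding R_rel_def \<tau> by blast
qed

text \<open>\<open>F\<close> commutes with the diagonal action and is injective. One direction makes
  the induced map well defined, the other makes it injective.\<close>

lemma approx_F_eq_iff:
  assumes F: "F \<in> Aut_Pure X" and X: "s \<in> X" "t \<in> X"
  shows "approx (F s) = approx (F t) \<longleftrightarrow> approx s = approx t"
proof -
  have "F t = act (diag_matrix u) (F s) \<longleftrightarrow> t = act (diag_matrix u) s" if "u \<in> Zhat_units" for u
    using that X F_inj[OF F] F_act_diag[OF F] act_diag_closed by metis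
  then show ?thesis by (auto simp: approx_eq_iff Delta_rel_def)
qed

lemma induced_exists:
  assumes F: "F \<in> Aut_Pure X"
  obtains f where "f \<in> Bij (approx ` X)" "induces X F f"
proof -
  define f where "f = restrict (\<lambda>y. approx (F (SOME s. s \<in> X \<and> approx s = y))) (approx ` X)"
  have f: "f (approx s) = approx (F s)" if "s \<in> X" for s
  proof -
    have "(SOME t. t \<in> X \<and> approx t = approx s) \<in> X \<and> approx (SOME t. t \<in> X \<and> approx t = approx s) = approx s"
      by (rule someI[of _ s]) (simp add: that)
    then show ?thesis using approx_F_eq_iff[OF F] that by (simp add: f_def)
  qed
  have FX: "F ` X = X" using F by (simp add: Aut_Pure_def Bij_def bij_betw_def)
  have "bij_betw f (approx ` X) (approx ` X)"
    unfolding bij_betw_def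
  proof
    show "inj_on f (approx ` X)"
      by (rule inj_onI) (auto simp: f approx_F_eq_iff[OF F])
    have "f ` approx ` X = approx ` F ` X" by (simp add: image_image f)
    then show "f ` approx ` X = approx ` X" by (simp add: FX)
  qed
  then have "f \<in> Bij (approx ` X)" by (simp add: Bij_def f_def)
  then show ?thesis using that f by (simp add: induces_def)
qed

text \<open>For \<open>s\<close> in \<open>component 1\<close>, its image must be moved by
  \<open>diag_matrix k\<close> to return there; carrying the action of \<open>g\<close> past this
  matrix conjugates \<open>g\<close>, which dictates \<phi>.\<close>

lemma Aut_H_tilde_induced:
  assumes F: "F \<in> Aut_Pure X" and f: "f \<in> Bij (approx ` X)" and ind: "induces X F f"
  obtains \<phi> where "(f, \<phi>) \<in> Aut_H_tilde X"
proof -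
  obtain k where k: "k \<in> Zhat_units"
    "\<And>s u. s \<in> X \<Longrightarrow> u \<in> Zhat_units \<Longrightarrow> s \<in> component u \<Longrightarrow> F s \<in> component (k * u)"
    using component_shift[OF F] by blast
  obtain k' where k': "k' \<in> Zhat_units" "k * k' = 1" using Zhat_units_inverse[OF k(1)] .
  have k'k: "k' * k = 1" using k' by (simp add: mult.commute)
  define \<phi> where "\<phi> = restrict (conj_diag k k') G_tilde"
  have Gamma_sub: "Gamma_tilde N \<subseteq> G_tilde" for N
    by (auto simp: Gamma_tilde_def G_tilde_iff Q_pos_1)
  have Delta_sub: "Delta_class g \<subseteq> G_tilde" if "g \<in> G_tilde" for g
    using that by (auto simp: Delta_class_iff conj_diag_in_G_tilde)
  have restr: "\<phi> ` B = conj_diag k k' ` B" if "B \<subseteq> G_tilde" for B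
    using that by (intro image_cong) (auto simp: \<phi>_def)
  have equivariant: "f (act_approx g y) = act_approx (\<phi> g) (f y)" if g: "g \<in> G_tilde" and y: "y \<in> approx ` X" for g y
  proof -
    obtain s0 where s0: "s0 \<in> X" "y = approx s0" using y by auto
    obtain v where v: "v \<in> Zhat_units" "act (diag_matrix v) s0 \<in> component 1"
      using approx_fibre[OF Zhat_units_1] .
    define s where "s = act (diag_matrix v) s0"
    have s: "s \<in> X" "s \<in> component 1" "y = approx s"
      using s0 v by (simp_all add: s_def act_diag_closed approx_act_diag)
    have inv: "invertible g" "invertible (diag_matrix k)" "invertible (diag_matrix k')"
      using g k k' by (simp_all add: G_tilde_invertible invertible_diag_matrix)
    define t where "t = act (diag_matrix k) (F s)"
    have "t \<in> component (k * 1 * k')"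
      unfolding t_def using k' s by (intro act_diag_mem_component k Zhat_units_1)
    then have t: "t \<in> component 1" using k' by simp
    have fy: "f y = approx t"
      using ind s k by (simp add: induces_def t_def approx_act_diag)
    have "f (act_approx g y) = approx (F (act g s))"
      using s g ind inv by (simp add: act_approx_approx induces_def act_closed)
    also have "\<dots> = approx (act (diag_matrix k) (act g (F s)))"
      using F_act[OF F] s inv k by (simp add: approx_act_diag)
    also have "act (diag_matrix k) (act g (F s)) = act (conj_diag k k' g) t"
      using inv act_diag_inverse[OF k'(1) k(1) k'k]
      by (simp add: t_def conj_diag_def act_mult invertible_mult)
    also have "approx \<dots> = act_approx (\<phi> g) (f y)"
      using t g conj_diag_in_G_tilde[OF k'(2) g] by (simp add: fy \<phi>_def act_approx_approx)
    finally show ?thesis .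
  qed
  let ?F' = "restrict (inv_into X F) X" and ?f' = "inv_into (approx ` X) f"
  have F_bij: "bij_betw F X X" using F by (simp add: Aut_Pure_def Bij_def)
  have f_bij: "bij_betw f (approx ` X) (approx ` X)" using f by (simp add: Bij_def)
  have ind': "induces X ?F' ?f'"
    unfolding induces_def
  proof
    fix s assume s: "s \<in> X"
    then have *: "inv_into X F s \<in> X" "F (inv_into X F s) = s"
      using F_bij by (auto simp: bij_betw_def inv_into_into f_inv_into_f)
    then have "f (approx (inv_into X F s)) = approx s" using ind by (simp add: induces_def)
    then have "?f' (approx s) = approx (inv_into X F s)"
      using f_bij * by (metis bij_betw_def imageI inv_into_f_f)
    then show "?f' (approx s) = approx (?F' s)" using s by simp
  qed
  have R: "R_rel s1 s2 t1 t2 \<longleftrightarrow> R_rel (f s1) (f s2) (f t1) (f t2)"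
    if mem: "s1 \<in> approx ` X" "s2 \<in> approx ` X" "t1 \<in> approx ` X" "t2 \<in> approx ` X" for s1 s2 t1 t2
  proof
    assume "R_rel s1 s2 t1 t2"
    then show "R_rel (f s1) (f s2) (f t1) (f t2)" by (rule R_rel_induced[OF F ind mem])
  next
    assume *: "R_rel (f s1) (f s2) (f t1) (f t2)"
    have "f x \<in> approx ` X" "?f' (f x) = x" if "x \<in> approx ` X" for x
      using that f_bij by (auto simp: bij_betw_def)
    then show "R_rel s1 s2 t1 t2"
      using R_rel_induced[OF Aut_Pure_inverse[OF F] ind' _ _ _ _ *] mem by metis
  qed
  have "(f, \<phi>) \<in> Aut_H_tilde X"
    unfolding Aut_H_tilde_def
  proof (intro CollectI case_prodI conjI ballI allI impI)
    show "\<phi> \<in> auto G_tilde_group" unfolding \<phi>_def by (rule conj_diag_auto[OF k'(2)])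
    show "\<phi> ` Delta_class g = Delta_class g" if "g \<in> G_tilde" for g
      using restr[OF Delta_sub[OF that]] conj_diag_Delta_class[OF k(1) k'] by simp
    show "\<phi> ` Gamma_tilde N = Gamma_tilde N" for N
      using restr[OF Gamma_sub] conj_diag_Gamma_tilde[OF k(1) k'] by simp
  qed (use f equivariant R in \<open>auto\<close>)
  then show ?thesis by (rule that)
qed

section \<open>Lifting automorphisms from the quotient\<close>

lemma Aut_H_tilde_lift:
  assumes "(f, \<phi>) \<in> Aut_H_tilde X"
  obtains F where "F \<in> Aut_Pure X" "induces X F f"
proof -
  have f: "f \<in> Bij (approx ` X)" and \<phi>: "\<phi> \<in> auto G_tilde_group"
    and equivariant: "\<And>g y. g \<in> G_tilde \<Longrightarrow> y \<in> approx ` X \<Longrightarrow> f (act_approx g y) = act_approx (\<phi> g) (f y)"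
    and Delta: "\<And>g. g \<in> G_tilde \<Longrightarrow> \<phi> ` Delta_class g = Delta_class g"
    using assms by (auto simp: Aut_H_tilde_def)
  obtain k k' where k: "k \<in> Zhat_units" "k' \<in> Zhat_units" "k * k' = 1"
    "\<And>g. g \<in> G_tilde \<Longrightarrow> \<phi> g = conj_diag k k' g"
    using G_tilde_auto_is_conj_diag[OF \<phi> Delta] by blast
  have f_mem: "f y \<in> approx ` X" if "y \<in> approx ` X" for y
    using Bij_imp_funcset[OF f] that by blast
  have bij: "bij_betw f (approx ` X) (approx ` X)" using f by (simp add: Bij_def)
  define P where "P s t \<longleftrightarrow> approx t = f (approx s) \<and> (\<exists>u\<in>Zhat_units. s \<in> component u \<and> t \<in> component (k * u))" for s t
  define F where "F = restrict (\<lambda>s. THE t. P s t) X"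
  have P_unique: "t = t'" if "P s t" "P s t'" for s t t'
  proof -
    obtain u u' where u: "u \<in> Zhat_units" "s \<in> component u" "t \<in> component (k * u)"
      "u' \<in> Zhat_units" "s \<in> component u'" "t' \<in> component (k * u')"
      using \<open>P s t\<close> \<open>P s t'\<close> by (auto simp: P_def)
    then have "u = u'" by (intro component_unique)
    then show ?thesis
      using u k(1) \<open>P s t\<close> \<open>P s t'\<close> approx_inj_component[of t t' "k * u"]
      by (simp add: P_def Zhat_units_mult)
  qed
  have P_ex: "\<exists>t. P s t" for s
  proof -
    obtain u where u: "u \<in> Zhat_units" "s \<in> component u" by (rule component_cover)
    obtain t0 where t0: "f (approx s) = approx t0" by (rule approx_surj)
    obtain v where v: "v \<in> Zhat_units" "act (diag_matrix v) t0 \<in> component (k * u)"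
      using approx_fibre Zhat_units_mult[OF k(1) u(1)] by blast
    then have "P s (act (diag_matrix v) t0)"
      using t0 u by (auto simp: P_def approx_act_diag)
    then show ?thesis by blast
  qed
  have F: "P s (F s)" if "s \<in> X" for s
    using theI'[of "P s"] P_ex P_unique that by (auto simp: F_def)
  have F_eq: "F s = t" if "s \<in> X" "P s t" for s t
    using P_unique F that by blast
  have approx_F: "approx (F s) = f (approx s)" if "s \<in> X" for s
    using F[OF that] by (simp add: P_def)
  have F_component: "F s \<in> component (k * u)" if "s \<in> X" "u \<in> Zhat_units" "s \<in> component u" for s u
    using F[OF that(1)] component_unique that by (auto simp: P_def)
  have F_mem: "F s \<in> X" if "s \<in> X" for s
    using approx_F[OF that] f_mem[of "approx s"] that approx_mem_iff[of "F s"] by simp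
  have F_component_iff: "F s \<in> component (k * u) \<longleftrightarrow> s \<in> component u" if "s \<in> X" "u \<in> Zhat_units" for s u
  proof
    assume *: "F s \<in> component (k * u)"
    obtain v where v: "v \<in> Zhat_units" "s \<in> component v" by (rule component_cover)
    then have "k * u = k * v"
      using F_component[OF that(1) v] component_unique[OF *] k that Zhat_units_mult by blast
    then have "k' * k * u = k' * k * v" by (simp only: mult.assoc)
    then have "u = v" using k(3) by (simp add: mult.commute)
    then show "s \<in> component u" using v by simp
  qed (rule F_component[OF that])
  have "bij_betw F X X"
    unfolding bij_betw_def
  proof
    show "inj_on F X"
    proof (rule inj_onI)
      fix s t assume *: "s \<in> X" "t \<in> X" "F s = F t"
      then have "f (approx s) = f (approx t)" using approx_F by metis
      then have eq: "approx s = approx t"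
        using bij * by (auto simp: bij_betw_def dest: inj_onD)
      obtain u where u: "u \<in> Zhat_units" "s \<in> component u" by (rule component_cover)
      then have "t \<in> component u" using * F_component_iff by metis
      with eq u show "s = t" using approx_inj_component by blast
    qed
    show "F ` X = X"
    proof (intro equalityI subsetI)
      fix t assume t: "t \<in> X"
      obtain u where u: "u \<in> Zhat_units" "t \<in> component u" by (rule component_cover)
      obtain y where y: "y \<in> approx ` X" "f y = approx t"
        using bij t by (metis bij_betw_def image_iff imageI)
      obtain s0 where s0: "s0 \<in> X" "y = approx s0" using y by auto
      \<comment> \<open>The preimage is sought in \<open>component (k' * u)\<close>, which
        \<open>F\<close> carries to the component of \<open>t\<close>.\<close>
      obtain v where v: "v \<in> Zhat_units" "act (diag_matrix v) s0 \<in> component (k' * u)"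
        using approx_fibre Zhat_units_mult[OF k(2) u(1)] by blast
      let ?s = "act (diag_matrix v) s0"
      have "k * (k' * u) = u" using k(3) by (simp add: mult.assoc[symmetric])
      then have "P ?s t"
        unfolding P_def using y u v s0 k(2) Zhat_units_mult
        by (intro conjI bexI[of _ "k' * u"]) (simp_all add: approx_act_diag)
      moreover have "?s \<in> X" using s0 v by (simp add: act_diag_closed)
      ultimately have "F ?s = t" by (intro F_eq)
      with \<open>?s \<in> X\<close> show "t \<in> F ` X" by blast
    qed (use F_mem in blast)
  qed
  then have F_Bij: "F \<in> Bij X" by (simp add: Bij_def F_def)
  have "F (act g s) = act g (F s)" if g: "invertible g" and s: "s \<in> X" for g s
  proof (rule F_eq)
    show "act g s \<in> X" using g s by (rule act_closed)
    obtain d where "det g * d = 1" using invertible_det_adele[OF g] .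
    then obtain q v where q: "q \<in> Q_pos" "v \<in> Zhat_units" "det g = q * v"
      by (rule adele_unit_decomposition)
    obtain v' where v': "v' \<in> Zhat_units" "v * v' = 1" using Zhat_units_inverse[OF q(2)] .
    obtain u where u: "u \<in> Zhat_units" "s \<in> component u" by (rule component_cover)
    obtain u' where u': "u' \<in> Zhat_units" "u * u' = 1" using Zhat_units_inverse[OF u(1)] .
    have u'u: "u' * u = 1" using u' by (simp add: mult.commute)
    \<comment> \<open>\<open>w\<close> is the component of \<open>act g s\<close>. The flanking
      diagonal matrices bring \<open>s\<close> and \<open>act g s\<close> to
      \<open>component 1\<close>, so \<open>h\<close> has rational determinant even when
      \<open>g\<close> is outside \<open>G_tilde\<close>.\<close>
    define w where "w = u * v'"
    have w: "w \<in> Zhat_units" using u v' by (simp add: w_def Zhat_units_mult)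
    define h where "h = diag_matrix w ** g ** diag_matrix u'"
    have "det h = q * ((v * v') * (u * u'))" by (simp add: h_def det_mul q(3) w_def ac_simps)
    then have h: "h \<in> G_tilde" using q v' u' by (simp add: G_tilde_iff)
    define s0 where "s0 = act (diag_matrix u) s"
    have s0: "s0 \<in> X" "s0 \<in> component 1"
      using s u act_diag_mem_component[OF u(2,1) u'(2)] u'(2) by (simp_all add: s0_def act_diag_closed)
    have inv: "invertible (diag_matrix z)" if "z \<in> Zhat_units" for z :: adele
      using that by (rule invertible_diag_matrix)
    have h_s0: "act h s0 = act (diag_matrix w) (act g s)"
      using inv g u u' w act_diag_inverse[OF u'(1) u(1) u'u]
      by (simp add: h_def s0_def act_mult invertible_mult)
    have ku: "k * u \<in> Zhat_units" "k' * u' \<in> Zhat_units"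
      using k u u' by (simp_all add: Zhat_units_mult)
    have "(k * u) * (k' * u') = (k * k') * (u * u')" by (simp add: ac_simps)
    then have ku1: "(k * u) * (k' * u') = 1" using k u' by simp
    define t0 where "t0 = act (diag_matrix (k * u)) (F s)"
    have "t0 \<in> component ((k * u) * (k' * u'))"
      unfolding t0_def using F_component[OF s u] ku ku1 by (intro act_diag_mem_component)
    then have t0: "t0 \<in> component 1" using ku1 by simp
    have f_s0: "f (approx s0) = approx t0"
      using s u ku by (simp add: s0_def t0_def approx_act_diag approx_F)
    \<comment> \<open>The twist of \<open>h\<close> by \<open>k\<close> cancels against the shift of
      \<open>F s\<close> by \<open>k * u\<close>, up to diagonal factors on the left that vanish in
      the quotient.\<close>
    have "diag_matrix k ** h ** diag_matrix k' ** diag_matrix (k * u)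
        = diag_matrix k ** diag_matrix w ** g ** diag_matrix (u' * k' * (k * u))"
      by (simp add: h_def diag_matrix_mult matrix_mul_assoc)
    also have "u' * k' * (k * u) = 1" using ku1 by (simp add: ac_simps)
    finally have conj: "conj_diag k k' h ** diag_matrix (k * u) = diag_matrix k ** diag_matrix w ** g"
      by (simp add: conj_diag_def)
    have h': "conj_diag k k' h \<in> G_tilde" using conj_diag_in_G_tilde[OF k(3) h] .
    have "f (approx (act g s)) = f (act_approx h (approx s0))"
      using s0 h w by (simp add: act_approx_approx h_s0 approx_act_diag)
    also have "\<dots> = act_approx (conj_diag k k' h) (approx t0)"
      using equivariant[OF h, of "approx s0"] s0 k(4)[OF h] f_s0 by simp
    also have "\<dots> = approx (act (conj_diag k k' h ** diag_matrix (k * u)) (F s))"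
      using act_approx_approx[OF t0 h'] inv[OF ku(1)] G_tilde_invertible[OF h']
      by (simp add: t0_def act_mult)
    also have "\<dots> = approx (act g (F s))"
      unfolding conj using inv g w k by (simp add: act_mult invertible_mult approx_act_diag)
    finally have "approx (act g (F s)) = f (approx (act g s))" by simp
    moreover have "act g s \<in> component (u * v')"
      by (rule act_mem_component[OF u(2) g q(3,1) v'(2)])
    moreover have "act g (F s) \<in> component (k * u * v')"
      by (rule act_mem_component[OF F_component[OF s u] g q(3,1) v'(2)])
    ultimately show "P (act g s) (act g (F s))"
      using w unfolding P_def w_def by (metis mult.assoc)
  qed
  moreover have "same_component s t \<longleftrightarrow> same_component (F s) (F t)" if st: "s \<in> X" "t \<in> X" for s t
  proof
    assume "same_component s t"
    then show "same_component (F s) (F t)"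
      unfolding same_component_def using st F_component k(1) Zhat_units_mult by blast
  next
    assume *: "same_component (F s) (F t)"
    obtain u where u: "u \<in> Zhat_units" "s \<in> component u" by (rule component_cover)
    have "F t \<in> component (k * u)"
      using same_componentD[OF * F_component[OF st(1) u]] k u Zhat_units_mult by blast
    then show "same_component s t"
      unfolding same_component_def using u st F_component_iff by blast
  qed
  ultimately have "F \<in> Aut_Pure X" using F_Bij by (simp add: Aut_Pure_def)
  then show ?thesis using that approx_F by (simp add: induces_def)
qed

text \<open>The action of the upper unipotent group on the point \<open>[\<i>, 1]\<close> is free, so it detects the
  unit by which the group automorphism conjugates.\<close>

lemma Aut_H_tilde_unique:
  assumes "(f, \<phi>) \<in> Aut_H_tilde X" "(f, \<psi>) \<in> Aut_H_tilde X"
  shows "\<phi> = \<psi>"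
proof -
  have f: "f \<in> Bij (approx ` X)" and auto: "\<phi> \<in> auto G_tilde_group" "\<psi> \<in> auto G_tilde_group"
    and equivariant: "\<And>g y. g \<in> G_tilde \<Longrightarrow> y \<in> approx ` X \<Longrightarrow> f (act_approx g y) = act_approx (\<phi> g) (f y)"
    "\<And>g y. g \<in> G_tilde \<Longrightarrow> y \<in> approx ` X \<Longrightarrow> f (act_approx g y) = act_approx (\<psi> g) (f y)"
    and Delta: "\<And>g. g \<in> G_tilde \<Longrightarrow> \<phi> ` Delta_class g = Delta_class g"
    "\<And>g. g \<in> G_tilde \<Longrightarrow> \<psi> ` Delta_class g = Delta_class g"
    using assms by (auto simp: Aut_H_tilde_def)
  obtain k k' where k: "k * k' = 1" "\<And>g. g \<in> G_tilde \<Longrightarrow> \<phi> g = conj_diag k k' g"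
    using G_tilde_auto_is_conj_diag[OF auto(1) Delta(1)] by blast
  obtain l l' where l: "l * l' = 1" "\<And>g. g \<in> G_tilde \<Longrightarrow> \<psi> g = conj_diag l l' g"
    using G_tilde_auto_is_conj_diag[OF auto(2) Delta(2)] by blast
  define U :: "adele \<Rightarrow> adele^2^2" where "U x = vector [vector [1, x], vector [0, 1]]" for x
  have U: "U x \<in> G_tilde" "conj_diag a b (U 1) = U a" "matrix_inv (U x) = U (- x)" if "a * b = 1" for x a b
  proof -
    show "U x \<in> G_tilde" by (simp add: G_tilde_iff U_def det_2 Q_pos_1)
    show "conj_diag a b (U 1) = U a" using that by (simp add: matrix_eq_2 conj_diag_nth) (simp add: U_def)
    show "matrix_inv (U x) = U (- x)"
      by (rule matrix_inv_unique_ring) (simp_all add: U_def matrix_eq_2 matrix_mult_2)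
  qed
  let ?b = "pt \<i> (mat 1)"
  have "f ` approx ` X = approx ` X" using f by (simp add: Bij_def bij_betw_def)
  \<comment> \<open>Equivariance at \<open>y\<close> with \<open>U 1\<close> compares
    \<open>U k\<close> and \<open>U l\<close>, the images of \<open>U 1\<close> under the two group
    automorphisms, on the known point [\<i>, 1].\<close>
  then obtain y where y: "y \<in> approx ` X" "f y = approx ?b" using base by (metis image_iff imageI)
  have "act_approx (U k) (approx ?b) = act_approx (U l) (approx ?b)"
    using equivariant[OF _ y(1), of "U 1"] U(1,2) k l y(2) by metis
  then have "approx (act (U k) ?b) = approx (act (U l) ?b)"
    using U k by (simp add: act_approx_approx base_component)
  then have "act (U k) ?b = act (U l) ?b"
    using U k base_component Zhat_units_1 by (intro approx_inj_component act_G_tilde_mem_component)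
  moreover have inv: "invertible (U x)" for x using U(1) k G_tilde_invertible by blast
  moreover have inv1: "invertible (mat 1 :: adele^2^2)" by (auto simp: invertible_def)
  ultimately have "pt \<i> (U (- k)) = pt \<i> (U (- l))"
    using U(3) k by (simp add: act_pt)
  then obtain q where q: "\<i> = moebius_act q \<i>" "U (- l) = adele_matrix q ** U (- k)" "invertible q"
    using inv pt_eq_iff[of \<i> "U (- k)" \<i> "U (- l)"] by auto
  have "U (- l) ** U k = adele_matrix q ** (U (- k) ** U k)"
    using q(2) by (simp add: matrix_mul_assoc)
  moreover have "U (- k) ** U k = mat 1" "U (- l) ** U k = U (k - l)"
    by (simp_all add: U_def matrix_eq_2 matrix_mult_2)
  ultimately have qU: "adele_matrix q = U (k - l)" by simp
  then have "adele_of_rat (q$1$1) = adele_of_rat 1" "adele_of_rat (q$2$1) = adele_of_rat 0"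
    "adele_of_rat (q$2$2) = adele_of_rat 1" and q12: "adele_of_rat (q$1$2) = k - l"
    by (simp_all add: adele_matrix_def matrix_eq_2 U_def)
  then have "q$1$1 = 1" "q$2$1 = 0" "q$2$2 = 1" by (simp_all only: adele_of_rat_inject)
  \<comment> \<open>\<open>q\<close> is a translation fixing \<i>, hence trivial.\<close>
  then have "q$1$2 = 0" using q(1) by (simp add: moebius_act_def)
  then have "k = l" using q12 by simp
  moreover from this have "k' = l'" using k(1) l(1) unit_mult_shift[of l' l 1 k'] by (simp add: mult.commute)
  ultimately have "\<phi> g = \<psi> g" if "g \<in> G_tilde" for g using k l that by simp
  moreover have "\<phi> \<in> extensional G_tilde" "\<psi> \<in> extensional G_tilde"
    using auto by (auto simp: auto_def G_tilde_group_def dest: Bij_imp_extensional)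
  ultimately show ?thesis by (metis extensionalityI)
qed

section \<open>Identification of the automorphism groups, on all points and on CM-points\<close>

lemma bi_interpretable_and_lifting:
  "bi_interpretable (Aut_Pure_approx X) (Aut_H_tilde X)"
  "\<forall>F\<in>Aut_Pure X. \<exists>f \<phi>. (f, \<phi>) \<in> Aut_H_tilde X \<and> induces X F f"
  "\<forall>(f, \<phi>)\<in>Aut_H_tilde X. \<exists>F\<in>Aut_Pure X. induces X F f"
proof -
  show "\<forall>F\<in>Aut_Pure X. \<exists>f \<phi>. (f, \<phi>) \<in> Aut_H_tilde X \<and> induces X F f"
  proof
    fix F assume F: "F \<in> Aut_Pure X"
    obtain f where f: "f \<in> Bij (approx ` X)" "induces X F f" using induced_exists[OF F] .
    obtain \<phi> where "(f, \<phi>) \<in> Aut_H_tilde X" using Aut_H_tilde_induced[OF F f] .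
    with f show "\<exists>f \<phi>. (f, \<phi>) \<in> Aut_H_tilde X \<and> induces X F f" by blast
  qed
  show lift: "\<forall>(f, \<phi>)\<in>Aut_H_tilde X. \<exists>F\<in>Aut_Pure X. induces X F f"
    by (safe, erule Aut_H_tilde_lift) blast
  have "inj_on fst (Aut_H_tilde X)"
    using Aut_H_tilde_unique by (auto simp: inj_on_def)
  moreover have "fst ` Aut_H_tilde X = Aut_Pure_approx X"
  proof (intro equalityI subsetI)
    fix f assume "f \<in> fst ` Aut_H_tilde X"
    then obtain \<phi> where "(f, \<phi>) \<in> Aut_H_tilde X" by auto
    then show "f \<in> Aut_Pure_approx X"
      using lift by (auto simp: Aut_Pure_approx_def Aut_H_tilde_def)
  next
    fix f assume "f \<in> Aut_Pure_approx X"
    then obtain F where "F \<in> Aut_Pure X" "f \<in> Bij (approx ` X)" "induces X F f"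
      by (auto simp: Aut_Pure_approx_def)
    then obtain \<phi> where "(f, \<phi>) \<in> Aut_H_tilde X" by (rule Aut_H_tilde_induced)
    then show "f \<in> fst ` Aut_H_tilde X" by force
  qed
  ultimately show "bi_interpretable (Aut_Pure_approx X) (Aut_H_tilde X)"
    by (simp add: bi_interpretable_def bij_betw_def)
qed

end

interpretation all_points: invariant_points UNIV
  by unfold_locales auto

interpretation CM_points: invariant_points CM
proof
  fix g :: "adele^2^2" and s assume g: "invertible g" and s: "s \<in> CM"
  then obtain \<tau> a where a: "s = pt \<tau> a" "imaginary_quadratic \<tau>" "invertible a"
    by (auto simp: CM_def)
  then have "act g s = pt \<tau> (a ** matrix_inv g)"
    using g by (simp add: act_pt imaginary_quadratic_def)
  moreover have "invertible (a ** matrix_inv g)"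
    using a g by (intro invertible_mult invertible_matrix_inv)
  ultimately show "act g s \<in> CM" using a unfolding CM_def by blast
next
  have "imaginary_quadratic \<i>"
    unfolding imaginary_quadratic_def
    by (intro conjI exI[of _ "1::rat"] exI[of _ "0::rat"] exI[of _ "1::rat"]) simp_all
  moreover have "invertible (mat 1 :: adele^2^2)" by (auto simp: invertible_def)
  ultimately show "pt \<i> (mat 1) \<in> CM" unfolding CM_def by blast
qed

theorem mainTheorem3:
  shows "bi_interpretable (Aut_Pure_approx UNIV) (Aut_H_tilde UNIV) \<and>
    (\<forall>F\<in>Aut_Pure UNIV. \<exists>f \<phi>. (f, \<phi>) \<in> Aut_H_tilde UNIV \<and> induces UNIV F f) \<and>
    (\<forall>(f, \<phi>)\<in>Aut_H_tilde UNIV. \<exists>F\<in>Aut_Pure UNIV. induces UNIV F f) \<and>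
    bi_interpretable (Aut_Pure_approx CM) (Aut_H_tilde CM) \<and>
    (\<forall>F\<in>Aut_Pure CM. \<exists>f \<phi>. (f, \<phi>) \<in> Aut_H_tilde CM \<and> induces CM F f) \<and>
    (\<forall>(f, \<phi>)\<in>Aut_H_tilde CM. \<exists>F\<in>Aut_Pure CM. induces CM F f)"
  using all_points.bi_interpretable_and_lifting CM_points.bi_interpretable_and_lifting by blast

end
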